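(* Assume (H0), (H0'), (H1) and (H2), and let $R=\sup_{x\in\Omega}|x|$. Then there exists $c>0$ such that for every $u\in\mathcal{H}_{J,0}(\Omega)$ $$\mathcal{E}(u,u)\ge c\int_\Omega|u(x)|^2M(\rho|x|/R)\,dx.$$ If moreover $\liminf_{s\to0^+}\ell(s)>0$, then there exists $c>0$ such that for every $u\in\mathcal{H}_{J,0}(\Omega)$ $$\mathcal{E}(u,u)\ge c\int_\Omega|u(x)|^2\,\big|\log(\rho|x|/R)\big|\,dx.$$
   Context: Standing setting: $N\ge1$, $\Omega\subset\mathbb{R}^N$ bounded open, $B_\varepsilon=\{|z|<\varepsilon\}$. (H0): $J:\mathbb{R}^N\times\mathbb{R}^N\to[0,\infty)$ measurable, $J(x,y)=J(y,x)$, $\sup_x\int\min(1,|x-y|^2)J(x,y)\,dy<\infty$. (H0'): $J(x,y)\ge\mathcal{K}(x-y)\ge0$ with $\mathcal{K}\notin L^1(B_\varepsilon)$ for all $\varepsilon>0$. (H1): there exist $\rho>0$ and $\ell:(0,\rho)\to(0,\infty)$, bounded above and below by positive constants on $[\varepsilon,\rho)$ for every $\varepsilon\in(0,\rho)$, with $\mathcal{K}(z)=|z|^{-N}\ell(|z|)$ for $0<|z|<\rho$ and $M(r):=\int_r^\rho\ell(s)/s\,ds\to\infty$ as $r\to0^+$. (H2): $\lim_{s\to0^+}\ell(\lambda s)/\ell(s)=1$ for every $\lambda>0$. $Q_\Omega=(\Omega^c\times\Omega^c)^c$, $\mathcal{E}(u,v)=\frac12\iint_{Q_\Omega}(u(x)-u(y))(v(x)-v(y))J(x,y)\,dx\,dy$,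 and $\mathcal{H}_{J,0}(\Omega)$ is the set of measurable $u:\mathbb{R}^N\to\mathbb{R}$ with $u|_\Omega\in L^2(\Omega)$, $\mathcal{E}(u,u)<\infty$ and $u=0$ a.e. on $\Omega^c$. *)

theory Defs
  imports "HOL-Analysis.Analysis"
begin

definition QOmega :: "'a set \<Rightarrow> ('a \<times> 'a) set" where
  "QOmega \<Omega> = - ((- \<Omega>) \<times> (- \<Omega>))"

definition energy :: "('a::euclidean_space \<Rightarrow> 'a \<Rightarrow> real) \<Rightarrow> 'a set \<Rightarrow> ('a \<Rightarrow> real) \<Rightarrow> ennreal" where
  "energy J \<Omega> u = ennreal (1/2) *
     (\<integral>\<^sup>+ x. (\<integral>\<^sup>+ y. indicator (QOmega \<Omega>) (x, y) *
        ennreal ((u x - u y)\<^sup>2 * J x y) \<partial>lebesgue) \<partial>lebesgue)"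

definition HJ0 :: "('a::euclidean_space \<Rightarrow> 'a \<Rightarrow> real) \<Rightarrow> 'a set \<Rightarrow> ('a \<Rightarrow> real) set" where
  "HJ0 J \<Omega> = {u. u \<in> borel_measurable lebesgue
      \<and> set_integrable lebesgue \<Omega> (\<lambda>x. (u x)\<^sup>2)
      \<and> energy J \<Omega> u < \<infinity>
      \<and> (AE x in lebesgue. x \<notin> \<Omega> \<longrightarrow> u x = 0)}"

definition Mfun :: "(real \<Rightarrow> real) \<Rightarrow> real \<Rightarrow> real \<Rightarrow> real" where
  "Mfun l \<rho> r = enn2real (\<integral>\<^sup>+ s \<in> {r<..<\<rho>}. ennreal (l s / s) \<partial>lborel)"

end

theory Submission
  imports Defs
begin

text \<open>
  Translate the energy into a double integral of (u x - u (x + z))^2 k(z), where k is a Borel version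
  of the kernel K near the origin, and let tail k r be the k-mass of {r < |z|}. Discard all pairs
  except those with 4|x| < |z|. There (u x)^2 <= 2 (u x - u (x + z))^2 + 2 (u (x + z))^2; integrating
  in z, the left side yields the integral of u^2 tail(4|x|), while for y = x + z the last term only
  sees jumps with |y|/2 < |z| <= 2|y|. Slow variation of l makes the k-mass of that shell a small
  multiple of tail(4|y|) up to a constant, so the last term is absorbed, leaving a multiple of the
  squared L2 norm. That norm is controlled by a Poincare inequality: the squared L2 norm D(z) of
  u - u(. + z) satisfies D(2z) <= 4 D(z), and D(z) dominates the squared norm of u once z is longer
  than twice the radius of the domain. Finally M is at most a constant times tail, by integration in
  polar coordinates.
\<close>

section \<open>Lebesgue measure under translation, dilation and the norm\<close>

lemma nn_integral_lborel_translate: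
  fixes f :: "'a::euclidean_space \<Rightarrow> ennreal"
  assumes [measurable]: "f \<in> borel_measurable borel"
  shows "(\<integral>\<^sup>+ x. f (x + c) \<partial>lborel) = (\<integral>\<^sup>+ x. f x \<partial>lborel)"
proof -
  have "(\<integral>\<^sup>+ x. f x \<partial>lborel) = (\<integral>\<^sup>+ x. f x \<partial>distr lborel borel ((+) c))"
    by (simp only: lborel_distr_plus)
  also have "\<dots> = (\<integral>\<^sup>+ x. f (c + x) \<partial>lborel)"
    by (subst nn_integral_distr) auto
  finally show ?thesis by (simp add: add.commute)
qed

lemma AE_lborel_translate:
  fixes P :: "'a::euclidean_space \<Rightarrow> bool"
  assumes "AE x in lborel. P x"
  shows "AE x in lborel. P (c + x)"
proof -
  have "AE x in distr lborel borel ((+) c). P x"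
    using assms by (simp only: lborel_distr_plus)
  then show ?thesis
    by (rule AE_distrD[rotated]) simp
qed

lemma nn_integral_lborel_scale:
  fixes f :: "'a::euclidean_space \<Rightarrow> ennreal"
  assumes [measurable]: "f \<in> borel_measurable borel" and "c \<noteq> 0"
  shows "(\<integral>\<^sup>+ x. f x \<partial>lborel) = ennreal (\<bar>c\<bar> ^ DIM('a)) * (\<integral>\<^sup>+ x. f (c *\<^sub>R x) \<partial>lborel)"
proof -
  have "(\<integral>\<^sup>+ x. f x \<partial>lborel)
      = (\<integral>\<^sup>+ x. f x \<partial>density (distr lborel borel (\<lambda>x. 0 + c *\<^sub>R x)) (\<lambda>_. \<bar>c\<bar> ^ DIM('a)))"
    using lborel_affine[OF assms(2), of "0::'a"] by simp
  then show ?thesis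
    by (simp add: nn_integral_density nn_integral_distr nn_integral_cmult)
qed

lemma AE_lborel_scale:
  fixes P :: "'a::euclidean_space \<Rightarrow> bool"
  assumes "AE x in lborel. P x" "c \<noteq> 0"
  shows "AE x in lborel. P (c *\<^sub>R x)"
proof -
  have "AE x in density (distr lborel borel (\<lambda>x. 0 + c *\<^sub>R x)) (\<lambda>_. ennreal (\<bar>c\<bar> ^ DIM('a))). P x"
    using assms(1) by (subst lborel_affine[OF assms(2), of "0::'a", symmetric])
  then have "AE x in distr lborel borel (\<lambda>x. 0 + c *\<^sub>R x). P (x::'a)"
    using \<open>c \<noteq> 0\<close> by (subst (asm) AE_density) auto
  then show ?thesis
    using AE_distrD[of "\<lambda>x. 0 + c *\<^sub>R x" lborel borel P] by simp
qed

text \<open>Polar coordinates for radial integrands. The half-lines are stable under intersection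
  and generate the Borel sets; on each of them the left measure is the volume of a ball, and the
  right one integrates the derivative of that volume in the radius.\<close>

lemma distr_norm_lborel:
  "distr (lborel :: 'a::euclidean_space measure) borel norm
    = density lborel (\<lambda>s. ennreal (DIM('a) * unit_ball_vol DIM('a) * s ^ (DIM('a) - 1)) * indicator {0..} s)"
    (is "?L = ?R")
proof (rule measure_eqI_generator_eq[where E = "range (\<lambda>a. {..a})" and A = "\<lambda>i. {..real i}" and \<Omega> = UNIV])
  show "Int_stable (range (\<lambda>a::real. {..a}))"
    by (auto simp: Int_stable_def intro!: image_eqI[where x = "min _ _"])
  have L: "emeasure ?L {..a} = (if a < 0 then 0 else ennreal (unit_ball_vol DIM('a) * a ^ DIM('a)))" for a
  proof -
    have "norm -` {..a} = cball (0::'a) a"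
      by auto
    then show ?thesis
      by (auto simp: emeasure_distr emeasure_cball)
  qed
  show "emeasure ?L X = emeasure ?R X" if "X \<in> range (\<lambda>a. {..a})" for X
  proof -
    from that obtain a where X: "X = {..a}" by auto
    have "emeasure ?R X = (\<integral>\<^sup>+ s. ennreal (DIM('a) * unit_ball_vol DIM('a) * s ^ (DIM('a) - 1)) * indicator {0..a} s \<partial>lborel)"
      unfolding X by (subst emeasure_density) (auto intro!: nn_integral_cong simp: indicator_def)
    also have "\<dots> = (if a < 0 then 0 else ennreal (unit_ball_vol DIM('a) * a ^ DIM('a)))"
    proof (cases "a < 0")
      case False
      have "(\<integral>\<^sup>+ s. ennreal (DIM('a) * unit_ball_vol DIM('a) * s ^ (DIM('a) - 1)) * indicator {0..a} s \<partial>lborel)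
        = ennreal (unit_ball_vol DIM('a) * a ^ DIM('a) - unit_ball_vol DIM('a) * 0 ^ DIM('a))"
        using False by (intro nn_integral_FTC_Icc) (auto intro!: derivative_eq_intros)
      then show ?thesis using False by simp
    qed simp
    finally show ?thesis using L by (simp add: X)
  qed
  show "sets ?L = sigma_sets UNIV (range (\<lambda>a::real. {..a}))"
    by (simp, subst borel_eq_atMost) simp
  show "sets ?R = sigma_sets UNIV (range (\<lambda>a::real. {..a}))"
    by (simp, subst borel_eq_atMost) simp
  show "(\<Union>i. {..real i}) = UNIV"
    using real_arch_simple by auto
  show "emeasure ?L {..real i} \<noteq> \<infinity>" for i
    by (simp only: L) auto
qed auto

lemma nn_integral_radial:
  fixes f :: "real \<Rightarrow> ennreal"
  assumes [measurable]: "f \<in> borel_measurable borel"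
  shows "(\<integral>\<^sup>+ z. f (norm (z::'a::euclidean_space)) \<partial>lborel)
    = (\<integral>\<^sup>+ s. ennreal (DIM('a) * unit_ball_vol DIM('a) * s ^ (DIM('a) - 1)) * indicator {0..} s * f s \<partial>lborel)"
proof -
  have "(\<integral>\<^sup>+ z. f (norm (z::'a)) \<partial>lborel) = (\<integral>\<^sup>+ s. f s \<partial>distr (lborel :: 'a measure) borel norm)"
    by (simp add: nn_integral_distr)
  then show ?thesis
    by (simp only: distr_norm_lborel) (simp add: nn_integral_density)
qed

text \<open>
  Nothing is assumed on the measurability of l: the integral over s is then the supremum over
  simple functions below the integrand, and each of these can be integrated radially.
\<close>
lemma nn_integral_shell_le:
  fixes K :: "'a::euclidean_space \<Rightarrow> real" and l :: "real \<Rightarrow> real"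
  assumes K: "\<And>z. r < norm z \<Longrightarrow> norm z < \<rho> \<Longrightarrow> K z = l (norm z) / norm z ^ DIM('a)"
    and "0 \<le> r"
  shows "ennreal (DIM('a) * unit_ball_vol DIM('a)) * (\<integral>\<^sup>+ s \<in> {r<..<\<rho>}. ennreal (l s / s) \<partial>lborel)
    \<le> (\<integral>\<^sup>+ z. ennreal (K z) * indicator {z. r < norm z \<and> norm z < \<rho>} z \<partial>lborel)"
proof -
  define c where "c = DIM('a) * unit_ball_vol DIM('a)"
  have c: "c > 0" by (simp add: c_def)
  have "ennreal c * (\<integral>\<^sup>+ s \<in> {r<..<\<rho>}. ennreal (l s / s) \<partial>lborel) =
     (SUP g \<in> {g. simple_function lborel g \<and> g \<le> (\<lambda>s. ennreal (l s / s) * indicator {r<..<\<rho>} s)}. ennreal c * integral\<^sup>S lborel g)"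
    unfolding nn_integral_def by (simp add: SUP_mult_left_ennreal)
  also have "\<dots> \<le> (\<integral>\<^sup>+ z. ennreal (K z) * indicator {z. r < norm z \<and> norm z < \<rho>} z \<partial>lborel)"
  proof (rule SUP_least, clarify)
    fix g :: "real \<Rightarrow> ennreal"
    assume g: "simple_function lborel g" and le: "g \<le> (\<lambda>s. ennreal (l s / s) * indicator {r<..<\<rho>} s)"
    from g have [measurable]: "g \<in> borel_measurable borel"
      using borel_measurable_simple_function by fastforce
    have g0: "g s = 0" if "\<not> (r < s \<and> s < \<rho>)" for s
      using le_funD[OF le, of s] that by (auto simp: indicator_def)
    have "ennreal c * integral\<^sup>S lborel g = (\<integral>\<^sup>+ s. ennreal c * g s \<partial>lborel)"
      using g by (simp add: nn_integral_eq_simple_integral nn_integral_cmult)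
    \<comment> \<open>Dividing by the Jacobian \<open>s ^ (DIM('a) - 1)\<close> is harmless:
      \<open>g\<close> vanishes unless \<open>r < s\<close>, which forces
      \<open>s > 0\<close>.\<close>
    also have "\<dots> = (\<integral>\<^sup>+ s. ennreal (c * s ^ (DIM('a) - 1)) * indicator {0..} s * (g s * ennreal (1 / s ^ (DIM('a) - 1))) \<partial>lborel)"
    proof (rule nn_integral_cong)
      fix s
      show "ennreal c * g s = ennreal (c * s ^ (DIM('a) - 1)) * indicator {0..} s * (g s * ennreal (1 / s ^ (DIM('a) - 1)))"
      proof (cases "r < s \<and> s < \<rho>")
        case True
        then have s: "s > 0" using \<open>0 \<le> r\<close> by linarith
        have "ennreal (c * s ^ (DIM('a) - 1)) * ennreal (1 / s ^ (DIM('a) - 1)) = ennreal c"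
          using s c by (subst ennreal_mult[symmetric]) auto
        then show ?thesis using s by (simp add: mult.assoc mult.left_commute mult.commute)
      qed (simp add: g0)
    qed
    also have "\<dots> = (\<integral>\<^sup>+ z. g (norm (z::'a)) * ennreal (1 / norm z ^ (DIM('a) - 1)) \<partial>lborel)"
      unfolding c_def by (subst nn_integral_radial) auto
    also have "\<dots> \<le> (\<integral>\<^sup>+ z. ennreal (K z) * indicator {z. r < norm z \<and> norm z < \<rho>} z \<partial>lborel)"
    proof (rule nn_integral_mono)
      fix z :: 'a
      show "g (norm z) * ennreal (1 / norm z ^ (DIM('a) - 1)) \<le> ennreal (K z) * indicator {z. r < norm z \<and> norm z < \<rho>} z"
      proof (cases "r < norm z \<and> norm z < \<rho>")
        case True
        then have z: "norm z > 0" using \<open>0 \<le> r\<close> by linarith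
        have "g (norm z) \<le> ennreal (l (norm z) / norm z)"
          using le_funD[OF le, of "norm z"] True by simp
        then have "g (norm z) * ennreal (1 / norm z ^ (DIM('a) - 1)) \<le> ennreal (l (norm z) / norm z) * ennreal (1 / norm z ^ (DIM('a) - 1))"
          by (rule mult_right_mono) simp
        also have "\<dots> = ennreal (l (norm z) / norm z * (1 / norm z ^ (DIM('a) - 1)))"
          by (rule ennreal_mult''[symmetric]) simp
        also have "l (norm z) / norm z * (1 / norm z ^ (DIM('a) - 1)) = K z"
          using K[of z] True z by (simp add: power_eq_if)
        finally show ?thesis using True by simp
      qed (simp add: g0)
    qed
    finally show "ennreal c * integral\<^sup>S lborel g \<le> (\<integral>\<^sup>+ z. ennreal (K z) * indicator {z. r < norm z \<and> norm z < \<rho>} z \<partial>lborel)" .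
  qed
  finally show ?thesis unfolding c_def .
qed

section \<open>Slow variation of the kernel tail\<close>

definition tail :: "('a::euclidean_space \<Rightarrow> ennreal) \<Rightarrow> real \<Rightarrow> ennreal" where
  "tail k r = (\<integral>\<^sup>+ z. k z * indicator {z. r < norm z} z \<partial>lborel)"

text \<open>Open inside and closed outside, so that adjacent shells tile and a tail splits exactly
  into a shell and a smaller tail.\<close>

definition shell :: "('a::euclidean_space \<Rightarrow> ennreal) \<Rightarrow> real \<Rightarrow> real \<Rightarrow> ennreal" where
  "shell k r s = (\<integral>\<^sup>+ z. k z * indicator {z. r < norm z \<and> norm z \<le> s} z \<partial>lborel)"

lemma tail_antimono: "r \<le> s \<Longrightarrow> tail k s \<le> tail k r"
  unfolding tail_def by (intro nn_integral_mono mult_left_mono) (auto simp: indicator_def)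

lemma shell_le_tail: "shell k r s \<le> tail k r"
  unfolding tail_def shell_def by (intro nn_integral_mono mult_left_mono) (auto simp: indicator_def)

lemma tail_eq_shell_plus_tail:
  assumes [measurable]: "k \<in> borel_measurable borel" and "r \<le> s"
  shows "tail k r = shell k r s + tail k s"
  unfolding tail_def shell_def using assms(2)
  by (subst nn_integral_add[symmetric]) (auto intro!: nn_integral_cong simp: indicator_def)

lemma measurable_tail [measurable]:
  assumes [measurable]: "k \<in> borel_measurable borel" "f \<in> borel_measurable M"
  shows "(\<lambda>x. tail k (f x)) \<in> borel_measurable M"
  unfolding tail_def by measurable

text \<open>Dilation by 2 maps the shell between r and 2r onto the one between 2r and 4r, with
  Jacobian \<open>2 ^ DIM('a)\<close>. The bound \<open>2 * r < s0\<close> keeps the whole inner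
  shell where the pointwise comparison holds.\<close>

lemma shell_scale:
  fixes k :: "'a::euclidean_space \<Rightarrow> ennreal"
  assumes [measurable]: "k \<in> borel_measurable borel"
    and ratio: "AE z in lborel. norm z < s0 \<longrightarrow> ennreal q * k z \<le> 2 ^ DIM('a) * k (2 *\<^sub>R z)"
    and "2 * r < s0"
  shows "ennreal q * shell k r (2 * r) \<le> shell k (2 * r) (4 * r)"
proof -
  have "shell k (2 * r) (4 * r) = 2 ^ DIM('a) * (\<integral>\<^sup>+ z. k (2 *\<^sub>R z) * indicator {z. 2 * r < norm z \<and> norm z \<le> 4 * r} (2 *\<^sub>R z) \<partial>lborel)"
    unfolding shell_def
    by (subst nn_integral_lborel_scale[of _ 2]) (simp_all add: ennreal_power[symmetric])
  also have "\<dots> = (\<integral>\<^sup>+ z. 2 ^ DIM('a) * k (2 *\<^sub>R z) * indicator {z. r < norm z \<and> norm z \<le> 2 * r} z \<partial>lborel)"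
    by (subst nn_integral_cmult[symmetric]) (auto intro!: nn_integral_cong simp: indicator_def)
  also have "\<dots> \<ge> (\<integral>\<^sup>+ z. ennreal q * k z * indicator {z. r < norm z \<and> norm z \<le> 2 * r} z \<partial>lborel)"
  proof (rule nn_integral_mono_AE)
    show "AE z in lborel. ennreal q * k z * indicator {z. r < norm z \<and> norm z \<le> 2 * r} z
        \<le> 2 ^ DIM('a) * k (2 *\<^sub>R z) * indicator {z. r < norm z \<and> norm z \<le> 2 * r} z"
      using ratio by eventually_elim (use assms(3) in \<open>auto simp: indicator_def\<close>)
  qed
  also have "(\<integral>\<^sup>+ z. ennreal q * k z * indicator {z. r < norm z \<and> norm z \<le> 2 * r} z \<partial>lborel) = ennreal q * shell k r (2 * r)"
    unfolding shell_def by (subst nn_integral_cmult[symmetric]) (auto simp: mult.assoc)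
  finally show ?thesis .
qed

text \<open>From one dyadic shell to the next the mass shrinks at most by the factor q. Each of the
  n shells following the first therefore carries at least \<open>q ^ n\<close> times its mass, and
  all of them lie in the tail beyond 2r. The condition \<open>2 ^ n * r < s0\<close> allows n
  dilations.\<close>

lemma shell_power_le_tail:
  fixes k :: "'a::euclidean_space \<Rightarrow> ennreal"
  assumes [measurable]: "k \<in> borel_measurable borel"
    and ratio: "AE z in lborel. norm z < s0 \<longrightarrow> ennreal q * k z \<le> 2 ^ DIM('a) * k (2 *\<^sub>R z)"
    and q: "0 < q" "q < 1"
  shows "0 < r \<Longrightarrow> 2 ^ n * r < s0 \<Longrightarrow> ennreal (n * q ^ n) * shell k r (2 * r) \<le> tail k (2 * r)"
proof (induction n arbitrary: r)
  case (Suc n)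
  have qn: "q ^ n \<le> 1" using q by (simp add: power_le_one)
  have "2 * r \<le> 2 ^ Suc n * r" using Suc.prems(1) by simp
  then have 2: "2 * r < s0" using Suc.prems(2) by linarith
  have IH: "ennreal (n * q ^ n) * shell k (2 * r) (4 * r) \<le> tail k (4 * r)"
    using Suc.IH[of "2 * r"] Suc.prems by (simp add: mult_ac)
  \<comment> \<open>Split the coefficient as \<open>(q ^ n + n * q ^ n) * q\<close> and bound the
    first power by 1. The factor q pays for the dilation; the 1 then stands for the shell between 2r
    and 4r itself, the rest for the tail beyond it by induction.\<close>
  have "ennreal (Suc n * q ^ Suc n) * shell k r (2 * r)
      \<le> ennreal ((1 + n * q ^ n) * q) * shell k r (2 * r)"
    using q qn by (intro mult_right_mono ennreal_leI) (auto simp: algebra_simps)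
  also have "\<dots> = ennreal (1 + n * q ^ n) * (ennreal q * shell k r (2 * r))"
    using q by (simp add: ennreal_mult mult.assoc)
  also have "\<dots> \<le> ennreal (1 + n * q ^ n) * shell k (2 * r) (4 * r)"
    by (intro mult_left_mono shell_scale[OF assms(1) ratio 2]) simp
  also have "\<dots> = shell k (2 * r) (4 * r) + ennreal (n * q ^ n) * shell k (2 * r) (4 * r)"
    using q by (simp add: distrib_right)
  also have "\<dots> \<le> shell k (2 * r) (4 * r) + tail k (4 * r)"
    by (intro add_left_mono IH)
  also have "\<dots> = tail k (2 * r)"
    using Suc.prems tail_eq_shell_plus_tail[of k "2 * r" "4 * r"] by simp
  finally show ?case .
qed simp

text \<open>One shell is at most the fraction \<open>1 / (n * q ^ n)\<close> of the tail beyond it.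
  This fraction becomes arbitrarily small if n is fixed first and q is then moved close to 1, at the
  price of a smaller range of radii.\<close>

lemma tail_slowly_varying:
  fixes k :: "'a::euclidean_space \<Rightarrow> ennreal"
  assumes [measurable]: "k \<in> borel_measurable borel"
    and ratio: "\<And>q. 0 < q \<Longrightarrow> q < 1 \<Longrightarrow> \<exists>s0>0. AE z in lborel. norm z < s0 \<longrightarrow> ennreal q * k z \<le> 2 ^ DIM('a) * k (2 *\<^sub>R z)"
    and "\<eta> > 0"
  shows "\<exists>r0>0. \<forall>r. 0 < r \<and> r < r0 \<longrightarrow> tail k r \<le> ennreal (1 + \<eta>) * tail k (2 * r)"
proof -
  \<comment> \<open>With \<open>n > 2 / \<eta>\<close> and \<open>q ^ n > 1/2\<close> the product
    \<open>n * q ^ n\<close> exceeds \<open>1 / \<eta>\<close>.\<close>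
  obtain n :: nat where n: "2 / \<eta> < n" using reals_Archimedean2 by blast
  have "((\<lambda>q::real. q ^ n) \<longlongrightarrow> 1 ^ n) (at_left 1)"
    by (intro tendsto_intros)
  then have "\<forall>\<^sub>F q in at_left 1. (1/2::real) < q ^ n"
    by (rule order_tendstoD) simp
  moreover have "\<forall>\<^sub>F q::real in at_left 1. 0 < q \<and> q < 1"
    using eventually_at_left_real[of 0 "1::real"] by (auto elim!: eventually_mono)
  ultimately have "\<forall>\<^sub>F q::real in at_left 1. 1/2 < q ^ n \<and> 0 < q \<and> q < 1"
    by eventually_elim auto
  then obtain q :: real where q: "1/2 < q ^ n" "0 < q" "q < 1"
    using eventually_happens'[OF trivial_limit_at_left_real[of "1::real"]] by blast
  obtain s0 where s0: "s0 > 0" "AE z in lborel. norm z < s0 \<longrightarrow> ennreal q * k z \<le> 2 ^ DIM('a) * k (2 *\<^sub>R z)"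
    using ratio[OF q(2,3)] by blast
  have nq: "1 \<le> \<eta> * (n * q ^ n)"
  proof -
    have "2 < \<eta> * n" using n \<open>\<eta> > 0\<close> by (simp add: field_simps)
    then have "2 * (1/2) \<le> \<eta> * n * q ^ n" using q \<open>\<eta> > 0\<close> by (intro mult_mono) auto
    then show ?thesis by (simp add: mult.assoc)
  qed
  show ?thesis
  proof (intro exI[of _ "s0 / 2 ^ n"] conjI allI impI)
    show "s0 / 2 ^ n > 0" using s0 by simp
    fix r assume r: "0 < r \<and> r < s0 / 2 ^ n"
    then have "2 ^ n * r < s0" by (simp add: field_simps)
    then have *: "ennreal (n * q ^ n) * shell k r (2 * r) \<le> tail k (2 * r)"
      using shell_power_le_tail[OF assms(1) s0(2) q(2,3)] r by blast
    have "shell k r (2 * r) = 1 * shell k r (2 * r)" by simp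
    also have "\<dots> \<le> ennreal (\<eta> * (n * q ^ n)) * shell k r (2 * r)"
      using nq by (intro mult_right_mono) auto
    also have "\<dots> = ennreal \<eta> * (ennreal (n * q ^ n) * shell k r (2 * r))"
      using \<open>\<eta> > 0\<close> q by (simp add: ennreal_mult mult.assoc)
    also have "\<dots> \<le> ennreal \<eta> * tail k (2 * r)"
      by (intro mult_left_mono *) simp
    finally have "shell k r (2 * r) + tail k (2 * r) \<le> ennreal \<eta> * tail k (2 * r) + tail k (2 * r)"
      by (intro add_right_mono)
    then show "tail k r \<le> ennreal (1 + \<eta>) * tail k (2 * r)"
      using r \<open>\<eta> > 0\<close> tail_eq_shell_plus_tail[of k r "2 * r"] by (simp add: distrib_right add.commute)
  qed
qed

text \<open>This allows any fixed multiple of |x| as the argument of the weight. For small r, each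
  halving of the radius costs a factor 2, and finitely many halvings bring r below t r. For the
  remaining r the left side is at most the finite constant \<open>tail k (t * r0)\<close>, which the
  summand 1 absorbs.\<close>

lemma tail_scale_le:
  fixes k :: "'a::euclidean_space \<Rightarrow> ennreal"
  assumes [measurable]: "k \<in> borel_measurable borel"
    and slow: "\<exists>r0>0. \<forall>r. 0 < r \<and> r < r0 \<longrightarrow> tail k r \<le> 2 * tail k (2 * r)"
    and fin: "\<And>r. r > 0 \<Longrightarrow> tail k r < \<infinity>"
    and "t > 0"
  shows "\<exists>C. \<forall>r>0. tail k (t * r) \<le> ennreal C * (tail k r + 1)"
proof -
  obtain r0 where r0: "r0 > 0" "\<And>r. 0 < r \<Longrightarrow> r < r0 \<Longrightarrow> tail k r \<le> 2 * tail k (2 * r)"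
    using slow by blast
  have iter: "tail k (r / 2 ^ n) \<le> 2 ^ n * tail k r" if "0 < r" "r < r0" for n r
  proof (induction n)
    case (Suc n)
    have "(1::real) \<le> 2 * 2 ^ n" using one_le_power[of "2::real" "Suc n"] by simp
    then have "r / 2 ^ Suc n \<le> r" using that by (simp add: field_simps)
    then have "r / 2 ^ Suc n < r0" using that by linarith
    then have "tail k (r / 2 ^ Suc n) \<le> 2 * tail k (r / 2 ^ n)"
      using r0(2)[of "r / 2 ^ Suc n"] that by simp
    also have "\<dots> \<le> 2 * (2 ^ n * tail k r)" by (intro mult_left_mono Suc) simp
    finally show ?case by (simp add: mult.assoc)
  qed simp
  obtain n where n: "1 / t < 2 ^ n" using real_arch_pow[of 2 "1 / t"] by auto
  define c where "c = enn2real (tail k (t * r0))"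
  have c: "tail k (t * r0) = ennreal c" "c \<ge> 0"
    using fin[of "t * r0"] r0 \<open>t > 0\<close> by (auto simp: c_def)
  show ?thesis
  proof (intro exI[of _ "2 ^ n + c"] allI impI)
    fix r :: real assume "r > 0"
    show "tail k (t * r) \<le> ennreal (2 ^ n + c) * (tail k r + 1)"
    proof (cases "r < r0")
      case True
      have "r / 2 ^ n \<le> t * r" using n \<open>r > 0\<close> \<open>t > 0\<close> by (simp add: field_simps)
      then have "tail k (t * r) \<le> tail k (r / 2 ^ n)" by (rule tail_antimono)
      also have "\<dots> \<le> 2 ^ n * tail k r" by (rule iter) fact+
      also have "\<dots> \<le> ennreal (2 ^ n + c) * (tail k r + 1)"
        using c by (intro mult_mono) (auto simp: ennreal_power[symmetric])
      finally show ?thesis .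
    next
      case False
      then have "tail k (t * r) \<le> tail k (t * r0)" using \<open>t > 0\<close> by (intro tail_antimono) simp
      also have "\<dots> \<le> ennreal (2 ^ n + c) * 1" using c by (auto intro!: ennreal_leI)
      also have "\<dots> \<le> ennreal (2 ^ n + c) * (tail k r + 1)" by (intro mult_left_mono) auto
      finally show ?thesis .
    qed
  qed
qed

section \<open>Poincare and Hardy inequalities for the jump form\<close>

text \<open>Written in the displacement z, so that after exchanging the integrals the inner one is
  the squared norm of a translation difference.\<close>

definition jump_form :: "('a::euclidean_space \<Rightarrow> ennreal) \<Rightarrow> ('a \<Rightarrow> real) \<Rightarrow> ennreal" where
  "jump_form k u = (\<integral>\<^sup>+ x. \<integral>\<^sup>+ z. ennreal ((u x - u (x + z))\<^sup>2) * k z \<partial>lborel \<partial>lborel)"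

lemma square_le_two_diff_square: "(a::real)\<^sup>2 \<le> 2 * (a - b)\<^sup>2 + 2 * b\<^sup>2"
proof -
  have "0 \<le> (a - 2 * b)\<^sup>2" by simp
  then show ?thesis by (simp add: power2_eq_square algebra_simps)
qed

text \<open>The number n of doublings depends only on B and r: it takes any jump longer than r to
  one longer than 2B, at cost \<open>4 ^ n\<close>. Kernel mass at least 1 beyond r then suffices to
  dominate the squared norm.\<close>

lemma poincare_jump_form:
  fixes k :: "'a::euclidean_space \<Rightarrow> ennreal"
  assumes [measurable]: "k \<in> borel_measurable borel"
    and r: "r > 0" "tail k r \<ge> 1"
  shows "\<exists>C. \<forall>u \<in> borel_measurable borel. (AE x in lborel. B \<le> norm x \<longrightarrow> u x = 0) \<longrightarrow>
    (\<integral>\<^sup>+ x. ennreal ((u x)\<^sup>2) \<partial>lborel) \<le> ennreal C * jump_form k u"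
proof -
  obtain n where n: "2 * B / r < 2 ^ n" using real_arch_pow[of 2 "2 * B / r"] by auto
  show ?thesis
  proof (intro exI[of _ "4 ^ n"] ballI impI)
    fix u :: "'a \<Rightarrow> real" assume [measurable]: "u \<in> borel_measurable borel"
      and 0: "AE x in lborel. B \<le> norm x \<longrightarrow> u x = 0"
    define D where "D z = (\<integral>\<^sup>+ x. ennreal ((u x - u (x + z))\<^sup>2) \<partial>lborel)" for z
    have [measurable]: "D \<in> borel_measurable borel" unfolding D_def by measurable
    have double: "D (2 *\<^sub>R z) \<le> 4 * D z" for z
    proof -
      \<comment> \<open>Pass through the midpoint \<open>x + z\<close>; both halves have the same
        integral by translation invariance.\<close>
      have "D (2 *\<^sub>R z) \<le> (\<integral>\<^sup>+ x. 2 * ennreal ((u x - u (x + z))\<^sup>2) + 2 * ennreal ((u (x + z) - u (x + z + z))\<^sup>2) \<partial>lborel)"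
        unfolding D_def
      proof (rule nn_integral_mono)
        fix x
        have "(u x - u (x + 2 *\<^sub>R z))\<^sup>2 \<le> 2 * (u x - u (x + z))\<^sup>2 + 2 * (u (x + z) - u (x + z + z))\<^sup>2"
          using square_le_two_diff_square[of "u x - u (x + 2 *\<^sub>R z)" "u (x + z) - u (x + z + z)"]
          by (simp add: scaleR_2 add.assoc)
        then have "ennreal ((u x - u (x + 2 *\<^sub>R z))\<^sup>2) \<le> ennreal (2 * (u x - u (x + z))\<^sup>2 + 2 * (u (x + z) - u (x + z + z))\<^sup>2)"
          by (rule ennreal_leI)
        then show "ennreal ((u x - u (x + 2 *\<^sub>R z))\<^sup>2) \<le> 2 * ennreal ((u x - u (x + z))\<^sup>2) + 2 * ennreal ((u (x + z) - u (x + z + z))\<^sup>2)"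
          by (simp add: ennreal_mult)
      qed
      also have "\<dots> = 2 * D z + 2 * D z"
        using nn_integral_lborel_translate[of "\<lambda>x. ennreal ((u x - u (x + z))\<^sup>2)" z]
        by (simp add: nn_integral_add nn_integral_cmult D_def)
      finally show ?thesis by (simp add: distrib_right[symmetric])
    qed
    have iter: "D (2 ^ m *\<^sub>R z) \<le> 4 ^ m * D z" for m z
    proof (induction m)
      case (Suc m)
      have "D (2 ^ Suc m *\<^sub>R z) \<le> 4 * D (2 ^ m *\<^sub>R z)" using double[of "2 ^ m *\<^sub>R z"] by simp
      also have "\<dots> \<le> 4 * (4 ^ m * D z)" by (intro mult_left_mono Suc) simp
      finally show ?case by (simp add: mult.assoc)
    qed simp
    define U where "U = (\<integral>\<^sup>+ x. ennreal ((u x)\<^sup>2) \<partial>lborel)"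
    \<comment> \<open>A shift by at least 2B separates u from its translate: if x lies in the ball
      of radius B, then \<open>x + w\<close> does not, so the difference equals \<open>u x\<close>;
      outside the ball \<open>u x\<close> vanishes anyway.\<close>
    have far: "U \<le> D w" if "2 * B \<le> norm w" for w
      unfolding U_def D_def
    proof (rule nn_integral_mono_AE)
      have "AE x in lborel. B \<le> norm (w + x) \<longrightarrow> u (w + x) = 0"
        by (rule AE_lborel_translate[OF 0])
      with 0 show "AE x in lborel. ennreal ((u x)\<^sup>2) \<le> ennreal ((u x - u (x + w))\<^sup>2)"
      proof eventually_elim
        case (elim x)
        show ?case
        proof (cases "B \<le> norm x")
          case False
          have "norm w \<le> norm (w + x) + norm x" using norm_triangle_ineq4[of "w + x" x] by simp
          then have "B \<le> norm (w + x)" using that False by linarith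
          then show ?thesis using elim by (simp add: add.commute)
        qed (use elim in auto)
      qed
    qed
    have "U = U * 1" by simp
    also have "\<dots> \<le> U * tail k r" using r by (intro mult_left_mono) auto
    also have "\<dots> = (\<integral>\<^sup>+ z. U * (k z * indicator {z. r < norm z} z) \<partial>lborel)"
      unfolding tail_def by (simp add: nn_integral_cmult)
    also have "\<dots> \<le> (\<integral>\<^sup>+ z. 4 ^ n * (D z * k z) \<partial>lborel)"
    proof (rule nn_integral_mono)
      fix z :: 'a
      show "U * (k z * indicator {z. r < norm z} z) \<le> 4 ^ n * (D z * k z)"
      proof (cases "r < norm z")
        case True
        have "2 * B < 2 ^ n * r" using n r by (simp add: field_simps)
        also have "\<dots> \<le> 2 ^ n * norm z" using True by simp
        finally have "U \<le> D (2 ^ n *\<^sub>R z)" by (intro far) simp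
        also have "\<dots> \<le> 4 ^ n * D z" by (rule iter)
        finally have "U * k z \<le> 4 ^ n * D z * k z" by (rule mult_right_mono) simp
        then show ?thesis using True by (simp add: mult.assoc)
      qed simp
    qed
    also have "\<dots> = 4 ^ n * (\<integral>\<^sup>+ z. D z * k z \<partial>lborel)"
      by (rule nn_integral_cmult) simp
    also have "(\<integral>\<^sup>+ z. D z * k z \<partial>lborel) = (\<integral>\<^sup>+ z. \<integral>\<^sup>+ x. ennreal ((u x - u (x + z))\<^sup>2) * k z \<partial>lborel \<partial>lborel)"
      unfolding D_def by (simp add: nn_integral_multc)
    also have "\<dots> = jump_form k u"
      unfolding jump_form_def by (rule lborel_pair.Fubini') measurable
    finally show "(\<integral>\<^sup>+ x. ennreal ((u x)\<^sup>2) \<partial>lborel) \<le> ennreal (4 ^ n) * jump_form k u"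
      by (simp add: U_def ennreal_power[symmetric])
  qed
qed

lemma shell_le_quarter_tail:
  fixes k :: "'a::euclidean_space \<Rightarrow> ennreal"
  assumes [measurable]: "k \<in> borel_measurable borel"
    and fin: "\<And>r. r > 0 \<Longrightarrow> tail k r < \<infinity>"
    and slow: "\<And>\<eta>. \<eta> > 0 \<Longrightarrow> \<exists>r0>0. \<forall>r. 0 < r \<and> r < r0 \<longrightarrow> tail k r \<le> ennreal (1 + \<eta>) * tail k (2 * r)"
  shows "\<exists>c\<ge>0. \<forall>r>0. shell k (r / 2) (2 * r) \<le> ennreal (1/4) * tail k (4 * r) + ennreal c"
proof -
  \<comment> \<open>Going from r/2 to 4r takes three doublings, and \<open>(21/20) ^ 3\<close> is
    below \<open>1 + 1/4\<close>. The quarter is what the absorption needs: it is later multiplied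
    by 2, leaving a coefficient 1/2 < 1.\<close>
  obtain r0 where r0: "r0 > 0" "\<And>r. 0 < r \<Longrightarrow> r < r0 \<Longrightarrow> tail k r \<le> ennreal (21/20) * tail k (2 * r)"
    using slow[of "1/20"] by auto
  define c where "c = enn2real (tail k (r0 / 4))"
  have c: "tail k (r0 / 4) = ennreal c" "c \<ge> 0"
    using fin[of "r0 / 4"] r0 by (auto simp: c_def)
  show ?thesis
  proof (intro exI[of _ c] conjI allI impI)
    fix r :: real assume "r > 0"
    show "shell k (r / 2) (2 * r) \<le> ennreal (1/4) * tail k (4 * r) + ennreal c"
    proof (cases "2 * r < r0")
      case True
      \<comment> \<open>The shell is estimated with \<open>tail k (2 * r)\<close> added to both
        sides; this tail is finite and can be cancelled at the end.\<close>
      have "tail k (2 * r) + shell k (r / 2) (2 * r) = tail k (r / 2)"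
        using \<open>r > 0\<close> tail_eq_shell_plus_tail[of k "r / 2" "2 * r"] by (simp add: add.commute)
      also have "\<dots> \<le> ennreal (21/20) * tail k r" using r0(2)[of "r / 2"] True \<open>r > 0\<close> by simp
      also have "\<dots> \<le> ennreal (21/20) * (ennreal (21/20) * tail k (2 * r))"
        using r0(2)[of r] True \<open>r > 0\<close> by (intro mult_left_mono) auto
      also have "\<dots> \<le> ennreal (21/20) * (ennreal (21/20) * (ennreal (21/20) * tail k (4 * r)))"
        using r0(2)[of "2 * r"] True \<open>r > 0\<close> by (intro mult_left_mono) auto
      also have "\<dots> = ennreal (21/20 * (21/20 * (21/20))) * tail k (4 * r)"
        by (simp only: ennreal_mult' mult.assoc)
      also have "\<dots> \<le> ennreal (1 + 1/4) * tail k (4 * r)"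
        by (intro mult_right_mono ennreal_leI) auto
      also have "\<dots> = tail k (4 * r) + ennreal (1/4) * tail k (4 * r)"
        by (subst ennreal_plus) (auto simp: distrib_right)
      also have "\<dots> \<le> tail k (2 * r) + ennreal (1/4) * tail k (4 * r)"
        using \<open>r > 0\<close> by (intro add_right_mono tail_antimono) simp
      finally have "shell k (r / 2) (2 * r) \<le> ennreal (1/4) * tail k (4 * r)"
        using fin[of "2 * r"] \<open>r > 0\<close> by (auto simp: ennreal_add_left_cancel_le)
      then show ?thesis by (rule order_trans) simp
    next
      case False
      \<comment> \<open>Here \<open>r / 2 \<ge> r0 / 4\<close>, so the fixed constant c is
        enough.\<close>
      have "shell k (r / 2) (2 * r) \<le> tail k (r / 2)" by (rule shell_le_tail)
      also have "\<dots> \<le> ennreal c" using c False by (auto intro!: tail_antimono simp flip: c(1))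
      finally show ?thesis by (rule order_trans) simp
    qed
  qed (rule c)
qed

text \<open>Finiteness of X is essential here, whence the truncation to |x| > \<open>\<delta>\<close> below.\<close>
lemma ennreal_absorb_half:
  fixes X :: ennreal
  assumes "X \<le> 2 * F + 2 * (ennreal (1/4) * X + ennreal c * U)" "X < \<infinity>" "U < \<infinity>" "c \<ge> 0"
  shows "X \<le> ennreal (4 + 4 * c) * (F + U)"
proof (cases "F = \<infinity>")
  case True
  then show ?thesis using \<open>c \<ge> 0\<close> by (simp add: ennreal_mult_top)
next
  case False
  obtain x where x: "X = ennreal x" "x \<ge> 0" using assms(2) by (cases X) auto
  obtain f where f: "F = ennreal f" "f \<ge> 0" using False by (cases F) auto
  obtain w where w: "U = ennreal w" "w \<ge> 0" using assms(3) by (cases U) auto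
  have "2 * F + 2 * (ennreal q * X + ennreal c * U) = ennreal (2 * f + 2 * (q * x + c * w))" if "q \<ge> 0" for q
    using x f w \<open>c \<ge> 0\<close> that by (simp add: ennreal_mult)
  from this[of "1/4"] have "ennreal x \<le> ennreal (2 * f + 2 * (1/4 * x + c * w))"
    using assms(1) x(1) by simp
  then have "x \<le> 2 * f + 2 * (1/4 * x + c * w)"
    by (rule ennreal_le_iff[THEN iffD1, rotated]) (use x f w \<open>c \<ge> 0\<close> in auto)
  then have "x \<le> 4 * f + 4 * (c * w)" by simp
  moreover have "0 \<le> c * f" "0 \<le> w" using f w \<open>c \<ge> 0\<close> by auto
  ultimately have "x \<le> (4 + 4 * c) * (f + w)" by (simp add: algebra_simps)
  then have "ennreal x \<le> ennreal ((4 + 4 * c) * (f + w))" by (rule ennreal_leI)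
  then show ?thesis using x f w \<open>c \<ge> 0\<close> by (simp add: ennreal_mult)
qed

lemma hardy_jump_form:
  fixes k :: "'a::euclidean_space \<Rightarrow> ennreal"
  assumes [measurable]: "k \<in> borel_measurable borel"
    and fin: "\<And>r. r > 0 \<Longrightarrow> tail k r < \<infinity>"
    and slow: "\<And>\<eta>. \<eta> > 0 \<Longrightarrow> \<exists>r0>0. \<forall>r. 0 < r \<and> r < r0 \<longrightarrow> tail k r \<le> ennreal (1 + \<eta>) * tail k (2 * r)"
  shows "\<exists>C. \<forall>u \<in> borel_measurable borel. (\<integral>\<^sup>+ x. ennreal ((u x)\<^sup>2) \<partial>lborel) < \<infinity> \<longrightarrow>
    (\<integral>\<^sup>+ x. ennreal ((u x)\<^sup>2) * tail k (4 * norm x) \<partial>lborel)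
      \<le> ennreal C * (jump_form k u + (\<integral>\<^sup>+ x. ennreal ((u x)\<^sup>2) \<partial>lborel))"
proof -
  obtain c where c: "c \<ge> 0" "\<And>r. r > 0 \<Longrightarrow> shell k (r / 2) (2 * r) \<le> ennreal (1/4) * tail k (4 * r) + ennreal c"
    using shell_le_quarter_tail[OF assms] by blast
  show ?thesis
  proof (intro exI[of _ "4 + 4 * c"] ballI impI)
    fix u :: "'a \<Rightarrow> real" assume [measurable]: "u \<in> borel_measurable borel"
    define U where "U = (\<integral>\<^sup>+ x. ennreal ((u x)\<^sup>2) \<partial>lborel)"
    assume "(\<integral>\<^sup>+ x. ennreal ((u x)\<^sup>2) \<partial>lborel) < \<infinity>"
    then have U: "U < \<infinity>" by (simp add: U_def)
    define X where "X \<delta> = (\<integral>\<^sup>+ x. ennreal ((u x)\<^sup>2) * tail k (4 * norm x) * indicator {x. \<delta> < norm x} x \<partial>lborel)" for \<delta> :: real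
    have X_le: "X \<delta> \<le> ennreal (4 + 4 * c) * (jump_form k u + U)" if "\<delta> > 0" for \<delta>
    proof (rule ennreal_absorb_half)
      have "X \<delta> \<le> (\<integral>\<^sup>+ x. tail k (4 * \<delta>) * ennreal ((u x)\<^sup>2) \<partial>lborel)"
        unfolding X_def
      proof (rule nn_integral_mono)
        fix x :: 'a
        show "ennreal ((u x)\<^sup>2) * tail k (4 * norm x) * indicator {x. \<delta> < norm x} x \<le> tail k (4 * \<delta>) * ennreal ((u x)\<^sup>2)"
          by (auto simp: indicator_def mult.commute intro!: mult_left_mono tail_antimono)
      qed
      also have "\<dots> = tail k (4 * \<delta>) * U" unfolding U_def by (rule nn_integral_cmult) simp
      also have "\<dots> < \<infinity>" using fin[of "4 * \<delta>"] that U by (simp add: ennreal_mult_less_top)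
      finally show "X \<delta> < \<infinity>" .
      \<comment> \<open>The kernel restricted to the pairs kept in the argument: the jump is more
        than four times as long as |x|, and x lies outside the ball of radius
        \<open>\<delta>\<close>.\<close>
      define G :: "'a \<Rightarrow> 'a \<Rightarrow> ennreal" where
        "G x z = k z * indicator {z. 4 * norm x < norm z} z * indicator {x. \<delta> < norm x} x" for x z
      have [measurable]: "case_prod G \<in> borel_measurable (borel \<Otimes>\<^sub>M borel)"
        unfolding G_def by measurable
      have [measurable]: "(\<lambda>p. G (f p) (g p)) \<in> borel_measurable M"
        if [measurable]: "f \<in> M \<rightarrow>\<^sub>M borel" "g \<in> M \<rightarrow>\<^sub>M borel" for f g M
        unfolding G_def by measurable
      define Y where "Y = (\<integral>\<^sup>+ x. \<integral>\<^sup>+ z. ennreal ((u (x + z))\<^sup>2) * G x z \<partial>lborel \<partial>lborel)"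
      have "X \<delta> = (\<integral>\<^sup>+ x. \<integral>\<^sup>+ z. ennreal ((u x)\<^sup>2) * G x z \<partial>lborel \<partial>lborel)"
      proof -
        have "ennreal ((u x)\<^sup>2) * tail k (4 * norm x) * indicator {x. \<delta> < norm x} x
            = (\<integral>\<^sup>+ z. ennreal ((u x)\<^sup>2) * G x z \<partial>lborel)" for x
          unfolding G_def tail_def by (subst nn_integral_cmult) (simp_all add: nn_integral_multc mult.assoc[of "ennreal _"])
        then show ?thesis by (simp add: X_def)
      qed
      also have "\<dots> \<le> (\<integral>\<^sup>+ x. \<integral>\<^sup>+ z. 2 * (ennreal ((u x - u (x + z))\<^sup>2) * k z) + 2 * (ennreal ((u (x + z))\<^sup>2) * G x z) \<partial>lborel \<partial>lborel)"
      proof (intro nn_integral_mono)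
        fix x z
        have "ennreal ((u x)\<^sup>2) \<le> ennreal (2 * (u x - u (x + z))\<^sup>2 + 2 * (u (x + z))\<^sup>2)"
          by (rule ennreal_leI) (rule square_le_two_diff_square)
        also have "\<dots> = 2 * ennreal ((u x - u (x + z))\<^sup>2) + 2 * ennreal ((u (x + z))\<^sup>2)"
          by (simp add: ennreal_mult)
        finally have "ennreal ((u x)\<^sup>2) * G x z \<le> (2 * ennreal ((u x - u (x + z))\<^sup>2) + 2 * ennreal ((u (x + z))\<^sup>2)) * G x z"
          by (rule mult_right_mono) simp
        also have "\<dots> = 2 * ennreal ((u x - u (x + z))\<^sup>2) * G x z + 2 * (ennreal ((u (x + z))\<^sup>2) * G x z)"
          by (simp add: distrib_right mult.assoc)
        also have "\<dots> \<le> 2 * ennreal ((u x - u (x + z))\<^sup>2) * k z + 2 * (ennreal ((u (x + z))\<^sup>2) * G x z)"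
          by (intro add_right_mono mult_left_mono) (auto simp: G_def indicator_def)
        finally show "ennreal ((u x)\<^sup>2) * G x z \<le> 2 * (ennreal ((u x - u (x + z))\<^sup>2) * k z) + 2 * (ennreal ((u (x + z))\<^sup>2) * G x z)"
          by (simp add: mult.assoc)
      qed
      also have "\<dots> = 2 * jump_form k u + 2 * Y"
        unfolding jump_form_def Y_def by (simp add: nn_integral_add nn_integral_cmult)
      also have "Y = (\<integral>\<^sup>+ z. \<integral>\<^sup>+ x. ennreal ((u (x + z))\<^sup>2) * G x z \<partial>lborel \<partial>lborel)"
        unfolding Y_def by (rule lborel_pair.Fubini'[symmetric]) measurable
      \<comment> \<open>Substitute y = x + z for fixed z, so that the square of u depends on the
        outer variable alone once the integrals are exchanged back.\<close>
      also have "\<dots> = (\<integral>\<^sup>+ z. \<integral>\<^sup>+ y. ennreal ((u y)\<^sup>2) * G (y - z) z \<partial>lborel \<partial>lborel)"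
      proof (rule nn_integral_cong)
        fix z :: 'a
        show "(\<integral>\<^sup>+ x. ennreal ((u (x + z))\<^sup>2) * G x z \<partial>lborel) = (\<integral>\<^sup>+ y. ennreal ((u y)\<^sup>2) * G (y - z) z \<partial>lborel)"
          using nn_integral_lborel_translate[of "\<lambda>y. ennreal ((u y)\<^sup>2) * G (y - z) z" z] by simp
      qed
      also have "\<dots> = (\<integral>\<^sup>+ y. \<integral>\<^sup>+ z. ennreal ((u y)\<^sup>2) * G (y - z) z \<partial>lborel \<partial>lborel)"
        by (rule lborel_pair.Fubini') measurable
      also have "\<dots> \<le> (\<integral>\<^sup>+ y. ennreal (1/4) * (ennreal ((u y)\<^sup>2) * tail k (4 * norm y) * indicator {y. \<delta> < norm y} y) + ennreal c * ennreal ((u y)\<^sup>2) \<partial>lborel)"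
      proof (rule nn_integral_mono)
        fix y :: 'a
        \<comment> \<open>With x = y - z and |x| < |z|/4, the norm of y lies between 3/4 and 5/4 of
          that of z, which gives the shell. Also |y| > 3|x|, so y stays outside the truncation ball
          and the same \<open>X \<delta>\<close> reappears on the right.\<close>
        have geom: "norm y / 2 < norm z \<and> norm z \<le> 2 * norm y \<and> \<delta> < norm y"
          if "4 * norm (y - z) < norm z" "\<delta> < norm (y - z)" for z
          using that norm_triangle_ineq2[of z y] norm_triangle_ineq2[of y z] by (auto simp: norm_minus_commute)
        have "(\<integral>\<^sup>+ z. G (y - z) z \<partial>lborel) \<le> (\<integral>\<^sup>+ z. k z * indicator {z. norm y / 2 < norm z \<and> norm z \<le> 2 * norm y} z * indicator {y. \<delta> < norm y} y \<partial>lborel)"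
          unfolding G_def
        proof (rule nn_integral_mono)
          fix z :: 'a
          show "k z * indicator {w. 4 * norm (y - z) < norm w} z * indicator {x. \<delta> < norm x} (y - z)
            \<le> k z * indicator {z. norm y / 2 < norm z \<and> norm z \<le> 2 * norm y} z * indicator {y. \<delta> < norm y} y"
            using geom[of z] by (auto simp: indicator_def)
        qed
        also have "\<dots> = shell k (norm y / 2) (2 * norm y) * indicator {y. \<delta> < norm y} y"
          unfolding shell_def by (simp add: nn_integral_multc)
        also have "\<dots> \<le> ennreal (1/4) * (tail k (4 * norm y) * indicator {y. \<delta> < norm y} y) + ennreal c"
        proof (cases "\<delta> < norm y")
          case True
          then have "norm y > 0" using \<open>\<delta> > 0\<close> by linarith
          from c(2)[OF this] show ?thesis using True by simp
        qed simp
        finally have "ennreal ((u y)\<^sup>2) * (\<integral>\<^sup>+ z. G (y - z) z \<partial>lborel)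
          \<le> ennreal ((u y)\<^sup>2) * (ennreal (1/4) * (tail k (4 * norm y) * indicator {y. \<delta> < norm y} y) + ennreal c)"
          by (rule mult_left_mono) simp
        then show "(\<integral>\<^sup>+ z. ennreal ((u y)\<^sup>2) * G (y - z) z \<partial>lborel)
            \<le> ennreal (1/4) * (ennreal ((u y)\<^sup>2) * tail k (4 * norm y) * indicator {y. \<delta> < norm y} y) + ennreal c * ennreal ((u y)\<^sup>2)"
          by (subst nn_integral_cmult) (simp_all add: distrib_left mult_ac)
      qed
      also have "\<dots> = ennreal (1/4) * X \<delta> + ennreal c * U"
        unfolding X_def U_def by (simp add: nn_integral_add nn_integral_cmult)
      finally show "X \<delta> \<le> 2 * jump_form k u + 2 * (ennreal (1/4) * X \<delta> + ennreal c * U)"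
        by (simp add: mult_left_mono add_left_mono)
    qed (use U c in auto)
    \<comment> \<open>Remove the truncation by monotone convergence along
      \<open>1 / real (Suc n)\<close>. The origin, never reached by these sets, is a null
      set.\<close>
    have "(\<integral>\<^sup>+ x. ennreal ((u x)\<^sup>2) * tail k (4 * norm x) \<partial>lborel)
      = (\<integral>\<^sup>+ x. (SUP n. ennreal ((u x)\<^sup>2) * tail k (4 * norm x) * indicator {x. 1 / real (Suc n) < norm x} x) \<partial>lborel)"
    proof (rule nn_integral_cong_AE)
      show "AE x in lborel. ennreal ((u x)\<^sup>2) * tail k (4 * norm x)
        = (SUP n. ennreal ((u x)\<^sup>2) * tail k (4 * norm x) * indicator {x. 1 / real (Suc n) < norm x} x)"
        using AE_lborel_singleton[of "0::'a"]
      proof eventually_elim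
        case (elim x)
        then obtain n where "1 / real (Suc n) < norm x"
          using nat_approx_posE[of "norm x"] by auto
        then show ?case
          by (intro antisym SUP_upper2[of n] SUP_least) (auto simp: indicator_def)
      qed
    qed
    also have "\<dots> = (SUP n. X (1 / real (Suc n)))"
      unfolding X_def
    proof (rule nn_integral_monotone_convergence_SUP)
      show "incseq (\<lambda>n x. ennreal ((u x)\<^sup>2) * tail k (4 * norm x) * indicator {x. 1 / real (Suc n) < norm x} x)"
      proof (intro incseq_SucI le_funI mult_left_mono)
        fix n and x :: 'a
        have "1 / real (Suc (Suc n)) \<le> 1 / real (Suc n)" by (intro divide_left_mono) auto
        then show "(indicator {x. 1 / real (Suc n) < norm x} x :: ennreal) \<le> indicator {x. 1 / real (Suc (Suc n)) < norm x} x"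
          by (auto simp: indicator_def)
      qed simp
    qed simp
    also have "\<dots> \<le> ennreal (4 + 4 * c) * (jump_form k u + U)"
      by (intro SUP_least X_le) simp
    finally show "(\<integral>\<^sup>+ x. ennreal ((u x)\<^sup>2) * tail k (4 * norm x) \<partial>lborel)
      \<le> ennreal (4 + 4 * c) * (jump_form k u + (\<integral>\<^sup>+ x. ennreal ((u x)\<^sup>2) \<partial>lborel))"
      by (simp only: U_def)
  qed
qed

section \<open>From the jump form to the energy\<close>

text \<open>Here v is a Borel representative of u. Since u vanishes almost everywhere off the
  domain, pairs with both points outside contribute nothing to the jump form, so the restriction to
  \<open>QOmega \<Omega>\<close> loses nothing. The 2 undoes the 1/2 in
  \<open>energy\<close>.\<close>

lemma jump_form_le_energy:
  fixes J :: "'a::euclidean_space \<Rightarrow> 'a \<Rightarrow> real"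
  assumes [measurable]: "k \<in> borel_measurable borel" "v \<in> borel_measurable borel"
    and uv: "AE x in lborel. u x = v x"
    and u0: "AE x in lborel. x \<notin> \<Omega> \<longrightarrow> u x = 0"
    and kK: "AE z in lborel. k z \<le> ennreal (K z)"
    and K0: "\<And>z. 0 \<le> K z"
    and J: "\<And>x y. K (y - x) \<le> J x y"
  shows "jump_form k v \<le> 2 * energy J \<Omega> u"
proof -
  define I where "I x = (\<integral>\<^sup>+ y. indicator (QOmega \<Omega>) (x, y) * ennreal ((u x - u y)\<^sup>2 * J x y) \<partial>lborel)" for x
  have "jump_form k v \<le> (\<integral>\<^sup>+ x. I x \<partial>lborel)"
    unfolding jump_form_def
  proof (rule nn_integral_mono_AE)
    show "AE x in lborel. (\<integral>\<^sup>+ z. ennreal ((v x - v (x + z))\<^sup>2) * k z \<partial>lborel) \<le> I x"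
      using uv u0
    proof eventually_elim
      case (elim x)
      have "(\<integral>\<^sup>+ z. ennreal ((v x - v (x + z))\<^sup>2) * k z \<partial>lborel)
          = (\<integral>\<^sup>+ y. ennreal ((v x - v y)\<^sup>2) * k (y - x) \<partial>lborel)"
        using nn_integral_lborel_translate[of "\<lambda>y. ennreal ((v x - v y)\<^sup>2) * k (y - x)" x]
        by (simp add: add.commute)
      also have "\<dots> \<le> I x"
        unfolding I_def
      proof (rule nn_integral_mono_AE)
        have "AE y in lborel. k (- x + y) \<le> ennreal (K (- x + y))"
          by (rule AE_lborel_translate[OF kK])
        with uv u0 show "AE y in lborel. ennreal ((v x - v y)\<^sup>2) * k (y - x) \<le> indicator (QOmega \<Omega>) (x, y) * ennreal ((u x - u y)\<^sup>2 * J x y)"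
        proof eventually_elim
          case (elim y)
          show ?case
          proof (cases "x \<notin> \<Omega> \<and> y \<notin> \<Omega>")
            case True
            then have "v x = 0" "v y = 0" using elim \<open>u x = v x\<close> \<open>x \<notin> \<Omega> \<longrightarrow> u x = 0\<close> by auto
            then show ?thesis by simp
          next
            case False
            have "ennreal ((v x - v y)\<^sup>2) * k (y - x) \<le> ennreal ((v x - v y)\<^sup>2) * ennreal (K (y - x))"
              using elim by (intro mult_left_mono) auto
            also have "\<dots> = ennreal ((u x - u y)\<^sup>2 * K (y - x))"
              using elim \<open>u x = v x\<close> K0 by (simp add: ennreal_mult)
            also have "\<dots> \<le> ennreal ((u x - u y)\<^sup>2 * J x y)"
              by (intro ennreal_leI mult_left_mono J) simp
            finally show ?thesis using False by (auto simp: QOmega_def)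
          qed
        qed
      qed
      finally show ?case .
    qed
  qed
  also have "\<dots> = 2 * energy J \<Omega> u"
  proof -
    have "energy J \<Omega> u = ennreal (1/2) * (\<integral>\<^sup>+ x. I x \<partial>lborel)"
      unfolding energy_def I_def by (simp add: nn_integral_completion)
    moreover have "2 * (ennreal (1/2) * A) = A" for A
    proof -
      have "2 * ennreal (1/2) = ennreal (2 * (1/2))" by (subst ennreal_mult) auto
      then show ?thesis by (simp add: mult.assoc[symmetric])
    qed
    ultimately show ?thesis by simp
  qed
  finally show ?thesis .
qed

text \<open>The weight is the extended-valued integral defining M, plus 1. The summand comes from
  the Poincare inequality and lets the final theorem absorb bounded errors, so this one estimate
  serves both of its claims.\<close>

lemma hardy_energy:
  fixes J :: "'a::euclidean_space \<Rightarrow> 'a \<Rightarrow> real"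
    and K :: "'a \<Rightarrow> real"
    and l :: "real \<Rightarrow> real"
  assumes "bounded \<Omega>"
    and J_sym: "\<And>x y. J x y = J y x"
    and K_meas [measurable]: "K \<in> borel_measurable lebesgue"
    and JK: "\<And>x y. J x y \<ge> K (x - y)"
    and K0: "\<And>z. K z \<ge> 0"
    and "\<rho> > 0"
    and l_pos: "\<And>s. 0 < s \<Longrightarrow> s < \<rho> \<Longrightarrow> l s > 0"
    and l_bdd: "\<And>\<epsilon>. 0 < \<epsilon> \<Longrightarrow> \<epsilon> < \<rho> \<Longrightarrow> \<exists>b. \<forall>s. \<epsilon> \<le> s \<and> s < \<rho> \<longrightarrow> l s \<le> b"
    and K_eq: "\<And>z. 0 < norm z \<Longrightarrow> norm z < \<rho> \<Longrightarrow> K z = l (norm z) / norm z ^ DIM('a)"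
    and M: "filterlim (Mfun l \<rho>) at_top (at_right 0)"
    and l_double: "((\<lambda>s. l (2 * s) / l s) \<longlongrightarrow> 1) (at_right 0)"
    and "t > 0"
  shows "\<exists>C. \<forall>u \<in> HJ0 J \<Omega>.
    (\<integral>\<^sup>+ x. ennreal ((u x)\<^sup>2) * ((\<integral>\<^sup>+ s \<in> {t * norm x<..<\<rho>}. ennreal (l s / s) \<partial>lborel) + 1) \<partial>lebesgue)
      \<le> ennreal C * energy J \<Omega> u"
proof -
  \<comment> \<open>Cut off at \<open>\<rho>\<close>, where the explicit formula for K ends: tails
    away from the origin become finite, while the kernel remains below K. The Borel version k agrees
    with it almost everywhere.\<close>
  define k0 where "k0 z = ennreal (K z) * indicator {z. 0 < norm z \<and> norm z < \<rho>} z" for z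
  have "k0 \<in> borel_measurable lebesgue"
  proof -
    have "(\<lambda>z::'a. indicator {z. 0 < norm z \<and> norm z < \<rho>} z :: ennreal) \<in> borel_measurable lborel"
      by measurable
    then have "(\<lambda>z::'a. indicator {z. 0 < norm z \<and> norm z < \<rho>} z :: ennreal) \<in> borel_measurable lebesgue"
      by (rule measurable_completion)
    then show ?thesis unfolding k0_def by measurable
  qed
  then obtain k where k [measurable]: "k \<in> borel_measurable lborel" and k_eq: "AE z in lborel. k0 z = k z"
    using completion_ex_borel_measurable[of k0 lborel] by blast
  have [measurable]: "k \<in> borel_measurable borel" using k by simp
  have tail_k: "tail k r = (\<integral>\<^sup>+ z. ennreal (K z) * indicator {z. r < norm z \<and> norm z < \<rho>} z \<partial>lborel)" if "r \<ge> 0" for r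
    unfolding tail_def
  proof (rule nn_integral_cong_AE)
    show "AE z in lborel. k z * indicator {z. r < norm z} z = ennreal (K z) * indicator {z. r < norm z \<and> norm z < \<rho>} z"
      using k_eq
    proof eventually_elim
      case (elim z)
      then show ?case using that by (auto simp: k0_def indicator_def simp flip: elim)
    qed
  qed
  have fin: "tail k r < \<infinity>" if "r > 0" for r
  proof (cases "r < \<rho>")
    case True
    obtain b where b: "\<And>s. r \<le> s \<Longrightarrow> s < \<rho> \<Longrightarrow> l s \<le> b" using l_bdd[OF \<open>r > 0\<close> True] by blast
    have "b \<ge> 0" using b[of r] l_pos[of r] True that by auto
    have "tail k r \<le> (\<integral>\<^sup>+ z. ennreal (b / r ^ DIM('a)) * indicator (ball (0::'a) \<rho>) z \<partial>lborel)"
      unfolding tail_k[OF less_imp_le[OF \<open>r > 0\<close>]]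
    proof (rule nn_integral_mono)
      fix z :: 'a
      show "ennreal (K z) * indicator {z. r < norm z \<and> norm z < \<rho>} z \<le> ennreal (b / r ^ DIM('a)) * indicator (ball 0 \<rho>) z"
      proof (cases "r < norm z \<and> norm z < \<rho>")
        case True
        then have z: "K z = l (norm z) / norm z ^ DIM('a)"
          using \<open>r > 0\<close> by (intro K_eq) linarith+
        have "K z \<le> b / r ^ DIM('a)"
          unfolding z using True b[of "norm z"] \<open>b \<ge> 0\<close> \<open>r > 0\<close> by (intro frac_le power_mono) auto
        then show ?thesis using True by (simp add: ennreal_leI)
      qed simp
    qed
    also have "\<dots> = ennreal (b / r ^ DIM('a)) * emeasure lborel (ball (0::'a) \<rho>)"
      by (simp add: nn_integral_cmult_indicator)
    also have "\<dots> < \<infinity>"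
      using emeasure_lborel_ball_finite[of "0::'a" \<rho>] by (simp add: ennreal_mult_less_top)
    finally show ?thesis .
  next
    case False
    have "tail k r = (\<integral>\<^sup>+ z. 0 \<partial>(lborel :: 'a measure))"
      unfolding tail_k[OF less_imp_le[OF \<open>r > 0\<close>]]
      using False by (intro nn_integral_cong) simp
    then show ?thesis by simp
  qed
  \<comment> \<open>The surface area of the unit sphere, which is the constant in polar
    coordinates.\<close>
  define w where "w = DIM('a) * unit_ball_vol DIM('a)"
  have w: "w > 0" by (simp add: w_def)
  define m where "m r = (\<integral>\<^sup>+ s \<in> {r<..<\<rho>}. ennreal (l s / s) \<partial>lborel)" for r
  have m_le: "ennreal w * m r \<le> tail k r" if "r \<ge> 0" for r
    unfolding tail_k[OF that] m_def w_def
    using that by (intro nn_integral_shell_le K_eq) auto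
  have m_le': "m r \<le> ennreal (1 / w) * tail k r" if "r \<ge> 0" for r
  proof -
    have "ennreal (1 / w) * ennreal w = 1"
      using w by (simp add: ennreal_mult[symmetric] del: ennreal_mult)
    then have "m r = ennreal (1 / w) * (ennreal w * m r)" by (simp add: mult.assoc[symmetric])
    also have "\<dots> \<le> ennreal (1 / w) * tail k r" by (intro mult_left_mono m_le that) simp
    finally show ?thesis .
  qed
  obtain r1 where r1: "r1 > 0" "tail k r1 \<ge> 1"
  proof -
    \<comment> \<open>The divergence of M provides a radius at which the tail is at least 1, as the
      Poincare inequality requires.\<close>
    have "\<forall>\<^sub>F r in at_right 0. 1 / w \<le> Mfun l \<rho> r"
      using M by (simp add: filterlim_at_top)
    moreover have "\<forall>\<^sub>F r::real in at_right 0. r > 0" by (simp add: eventually_at_right_less)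
    ultimately have "\<forall>\<^sub>F r in at_right 0. r > 0 \<and> 1 / w \<le> Mfun l \<rho> r"
      by eventually_elim auto
    then obtain r where r: "r > 0" "1 / w \<le> Mfun l \<rho> r"
      using eventually_happens'[OF trivial_limit_at_right_real[of "0::real"]] by blast
    have "1 = ennreal w * ennreal (1 / w)"
      using w by (simp add: ennreal_mult[symmetric] del: ennreal_mult)
    also have "\<dots> \<le> ennreal w * ennreal (Mfun l \<rho> r)"
      by (intro mult_left_mono ennreal_leI r) simp
    also have "\<dots> \<le> ennreal w * m r"
      unfolding Mfun_def m_def[symmetric] by (intro mult_left_mono) (auto simp: ennreal_enn2real_if)
    also have "\<dots> \<le> tail k r" using r by (intro m_le) simp
    finally show ?thesis using that r by blast
  qed
  have ratio: "\<exists>s0>0. AE z in lborel. norm z < s0 \<longrightarrow> ennreal q * k z \<le> 2 ^ DIM('a) * k (2 *\<^sub>R z)"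
    if q: "0 < q" "q < 1" for q
  proof -
    have "\<forall>\<^sub>F s in at_right 0. q < l (2 * s) / l s"
      using l_double q(2) by (rule order_tendstoD)
    then obtain b where b: "b > 0" "\<And>s. 0 < s \<Longrightarrow> s < b \<Longrightarrow> q < l (2 * s) / l s"
      unfolding eventually_at_right_field by auto
    show ?thesis
    \<comment> \<open>Below b the quotient \<open>l (2 * s) / l s\<close> exceeds q; below
      \<open>\<rho> / 2\<close> the formula for K holds at z and at 2z. The powers of the norm
      differ exactly by \<open>2 ^ DIM('a)\<close>.\<close>
    proof (intro exI[of _ "min b (\<rho> / 2)"] conjI)
      have "AE z in lborel. k0 (2 *\<^sub>R z) = k (2 *\<^sub>R z)"
        by (rule AE_lborel_scale[OF k_eq]) simp
      with k_eq AE_lborel_singleton[of "0::'a"]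
      show "AE z in lborel. norm z < min b (\<rho> / 2) \<longrightarrow> ennreal q * k z \<le> 2 ^ DIM('a) * k (2 *\<^sub>R z)"
      proof eventually_elim
        case (elim z)
        show ?case
        proof
          assume z: "norm z < min b (\<rho> / 2)"
          have z0: "norm z > 0" using elim by simp
          have z1: "norm z < \<rho>" using z z0 by linarith
          have l: "l (norm z) > 0" using z1 z0 by (intro l_pos) auto
          have "q * l (norm z) \<le> l (2 * norm z)"
            using b(2)[of "norm z"] z z0 l by (simp add: field_simps)
          then have "q * (l (norm z) / norm z ^ DIM('a)) \<le> l (2 * norm z) / norm z ^ DIM('a)"
            by (simp add: divide_right_mono)
          also have "\<dots> = 2 ^ DIM('a) * (l (2 * norm z) / (2 * norm z) ^ DIM('a))"
            by (simp add: power_mult_distrib)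
          finally have "q * K z \<le> 2 ^ DIM('a) * K (2 *\<^sub>R z)"
            using K_eq[of z] K_eq[of "2 *\<^sub>R z"] z z0 z1 by simp
          then have "ennreal (q * K z) \<le> ennreal (2 ^ DIM('a) * K (2 *\<^sub>R z))"
            by (rule ennreal_leI)
          then have "ennreal q * ennreal (K z) \<le> 2 ^ DIM('a) * ennreal (K (2 *\<^sub>R z))"
            using q K0 by (simp add: ennreal_mult ennreal_power[symmetric])
          then show "ennreal q * k z \<le> 2 ^ DIM('a) * k (2 *\<^sub>R z)"
            using elim z z0 z1 by (simp add: k0_def flip: elim(1,3))
        qed
      qed
    qed (use b \<open>\<rho> > 0\<close> in auto)
  qed
  note slow = tail_slowly_varying[OF \<open>k \<in> borel_measurable borel\<close> ratio]
  obtain C1 where C1: "\<And>u. u \<in> borel_measurable borel \<Longrightarrow> (\<integral>\<^sup>+ x. ennreal ((u x)\<^sup>2) \<partial>lborel) < \<infinity> \<Longrightarrow>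
      (\<integral>\<^sup>+ x. ennreal ((u x)\<^sup>2) * tail k (4 * norm x) \<partial>lborel)
      \<le> ennreal C1 * (jump_form k u + (\<integral>\<^sup>+ x. ennreal ((u x)\<^sup>2) \<partial>lborel))"
    using hardy_jump_form[OF \<open>k \<in> borel_measurable borel\<close> fin slow] by blast
  obtain B where B: "\<And>x. x \<in> \<Omega> \<Longrightarrow> norm x < B"
    using \<open>bounded \<Omega>\<close> unfolding bounded_iff by (meson less_add_one order_le_less_trans)
  obtain C2 where C2: "\<And>u. u \<in> borel_measurable borel \<Longrightarrow> (AE x in lborel. B \<le> norm x \<longrightarrow> u x = 0) \<Longrightarrow>
      (\<integral>\<^sup>+ x. ennreal ((u x)\<^sup>2) \<partial>lborel) \<le> ennreal C2 * jump_form k u"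
    using poincare_jump_form[OF \<open>k \<in> borel_measurable borel\<close> r1] by blast
  \<comment> \<open>The ratio \<open>t / 4\<close> compares the desired radius t|x| with the radius
    4|x| of the Hardy inequality.\<close>
  obtain C3 where C3: "\<And>r. r > 0 \<Longrightarrow> tail k (t / 4 * r) \<le> ennreal C3 * (tail k r + 1)"
    using tail_scale_le[OF \<open>k \<in> borel_measurable borel\<close> _ fin, of "t / 4"] slow[of 1] \<open>t > 0\<close>
    by auto
  define c where "c = 1 / w * max 0 C3"
  have c: "c \<ge> 0" "m (t * norm x) \<le> ennreal c * (tail k (4 * norm x) + 1)" if "x \<noteq> 0" for x :: 'a
  proof -
    show "c \<ge> 0" using w by (simp add: c_def)
    have "m (t * norm x) \<le> ennreal (1 / w) * tail k (t / 4 * (4 * norm x))"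
      using m_le'[of "t * norm x"] \<open>t > 0\<close> by simp
    also have "\<dots> \<le> ennreal (1 / w) * (ennreal C3 * (tail k (4 * norm x) + 1))"
      using that by (intro mult_left_mono C3) auto
    also have "\<dots> \<le> ennreal (1 / w) * (ennreal (max 0 C3) * (tail k (4 * norm x) + 1))"
      by (intro mult_left_mono mult_right_mono ennreal_leI) auto
    also have "\<dots> = ennreal c * (tail k (4 * norm x) + 1)"
      using w unfolding c_def by (subst ennreal_mult) (simp_all add: mult.assoc)
    finally show "m (t * norm x) \<le> ennreal c * (tail k (4 * norm x) + 1)" .
  qed
  have ex: "\<exists>C. ennreal C = A * 2" if "A < \<infinity>" for A :: ennreal
    using that by (intro exI[of _ "enn2real (A * 2)"]) (simp add: ennreal_mult_less_top)
  \<comment> \<open>\<open>C1\<close> is the Hardy constant and \<open>C2\<close> the Poincare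
    constant replacing each squared norm by the jump form; the final 2 passes from the jump form to
    the energy.\<close>
  obtain C where C: "ennreal C = (ennreal (c + 1) * (ennreal C1 * (1 + ennreal C2) + ennreal C2)) * 2"
    using ex[of "ennreal (c + 1) * (ennreal C1 * (1 + ennreal C2) + ennreal C2)"]
    by (auto simp: ennreal_mult_less_top)
  show ?thesis
  proof (intro exI[of _ C] ballI)
    fix u assume u: "u \<in> HJ0 J \<Omega>"
    have u_meas: "u \<in> borel_measurable lebesgue"
      and u_int: "set_integrable lebesgue \<Omega> (\<lambda>x. (u x)\<^sup>2)"
      and u0: "AE x in lborel. x \<notin> \<Omega> \<longrightarrow> u x = 0"
      using u by (auto simp: HJ0_def AE_completion_iff)
    obtain v where v: "v \<in> borel_measurable lborel" and uv: "AE x in lborel. u x = v x"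
      using completion_ex_borel_measurable_real[OF u_meas] by blast
    have [measurable]: "v \<in> borel_measurable borel" using v by simp
    define V where "V = (\<integral>\<^sup>+ x. ennreal ((v x)\<^sup>2) \<partial>lborel)"
    have "V = (\<integral>\<^sup>+ x. ennreal (indicator \<Omega> x *\<^sub>R (u x)\<^sup>2) \<partial>lborel)"
      unfolding V_def
    proof (rule nn_integral_cong_AE)
      show "AE x in lborel. ennreal ((v x)\<^sup>2) = ennreal (indicator \<Omega> x *\<^sub>R (u x)\<^sup>2)"
        using uv u0 by eventually_elim (auto simp: indicator_def)
    qed
    also have "\<dots> < \<infinity>"
      using u_int unfolding set_integrable_def
      by (auto simp: integrable_iff_bounded nn_integral_completion power_abs)
    finally have V: "V < \<infinity>" .
    have F: "jump_form k v \<le> 2 * energy J \<Omega> u"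
    proof (rule jump_form_le_energy[OF _ _ uv u0])
      show "AE z in lborel. k z \<le> ennreal (K z)"
        using k_eq
      proof eventually_elim
        case (elim z)
        show ?case unfolding elim[symmetric] by (auto simp: k0_def indicator_def)
      qed
      show "K (y - x) \<le> J x y" for x y using JK[where x=y and y=x] J_sym by simp
    qed (use K0 in auto)
    have V_le: "V \<le> ennreal C2 * jump_form k v"
      unfolding V_def
    proof (rule C2)
      show "AE x in lborel. B \<le> norm x \<longrightarrow> v x = 0"
        using uv u0 by eventually_elim (use B in force)
    qed simp
    have "(\<integral>\<^sup>+ x. ennreal ((u x)\<^sup>2) * (m (t * norm x) + 1) \<partial>lborel)
        \<le> (\<integral>\<^sup>+ x. ennreal (c + 1) * (ennreal ((v x)\<^sup>2) * tail k (4 * norm x) + ennreal ((v x)\<^sup>2)) \<partial>lborel)"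
    proof (rule nn_integral_mono_AE)
      show "AE x in lborel. ennreal ((u x)\<^sup>2) * (m (t * norm x) + 1)
        \<le> ennreal (c + 1) * (ennreal ((v x)\<^sup>2) * tail k (4 * norm x) + ennreal ((v x)\<^sup>2))"
        using uv AE_lborel_singleton[of "0::'a"]
      proof eventually_elim
        case (elim x)
        have "m (t * norm x) + 1 \<le> ennreal c * (tail k (4 * norm x) + 1) + 1 * (tail k (4 * norm x) + 1)"
          using c[of x] elim by (intro add_mono) auto
        also have "\<dots> = ennreal (c + 1) * (tail k (4 * norm x) + 1)"
          using c[of x] elim by (simp add: distrib_right del: mult_1)
        finally have "ennreal ((v x)\<^sup>2) * (m (t * norm x) + 1) \<le> ennreal ((v x)\<^sup>2) * (ennreal (c + 1) * (tail k (4 * norm x) + 1))"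
          by (rule mult_left_mono) simp
        then show ?case using elim by (simp add: distrib_left mult_ac)
      qed
    qed
    also have "\<dots> = ennreal (c + 1) * ((\<integral>\<^sup>+ x. ennreal ((v x)\<^sup>2) * tail k (4 * norm x) \<partial>lborel) + V)"
      unfolding V_def by (simp add: nn_integral_cmult nn_integral_add)
    also have "\<dots> \<le> ennreal (c + 1) * (ennreal C1 * (jump_form k v + V) + V)"
      using C1[of v] V by (intro mult_left_mono add_right_mono) (auto simp: V_def)
    also have "\<dots> \<le> ennreal (c + 1) * (ennreal C1 * (jump_form k v + ennreal C2 * jump_form k v) + ennreal C2 * jump_form k v)"
      by (intro mult_left_mono add_mono V_le order_refl) auto
    also have "\<dots> = ennreal (c + 1) * (ennreal C1 * (1 + ennreal C2) + ennreal C2) * jump_form k v"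
      by (simp add: distrib_left distrib_right mult_ac)
    also have "\<dots> \<le> ennreal (c + 1) * (ennreal C1 * (1 + ennreal C2) + ennreal C2) * (2 * energy J \<Omega> u)"
      by (intro mult_left_mono F) simp
    also have "\<dots> = ennreal C * energy J \<Omega> u"
      by (simp only: C mult.assoc)
    finally show "(\<integral>\<^sup>+ x. ennreal ((u x)\<^sup>2) * ((\<integral>\<^sup>+ s \<in> {t * norm x<..<\<rho>}. ennreal (l s / s) \<partial>lborel) + 1) \<partial>lebesgue)
      \<le> ennreal C * energy J \<Omega> u"
      by (simp add: nn_integral_completion m_def)
  qed
qed

text \<open>For non-measurable f, where \<open>nn_integral_cmult\<close> does not apply.\<close>
lemma nn_integral_cmult_le:
  fixes f :: "'a \<Rightarrow> ennreal"
  shows "c * (\<integral>\<^sup>+ x. f x \<partial>M) \<le> (\<integral>\<^sup>+ x. c * f x \<partial>M)"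
proof -
  have "c * (\<integral>\<^sup>+ x. f x \<partial>M) = (SUP g \<in> {g. simple_function M g \<and> g \<le> f}. c * integral\<^sup>S M g)"
    unfolding nn_integral_def by (simp add: SUP_mult_left_ennreal)
  also have "\<dots> \<le> (\<integral>\<^sup>+ x. c * f x \<partial>M)"
  proof (rule SUP_least, clarify)
    fix g assume g: "simple_function M g" "g \<le> f"
    then have "c * integral\<^sup>S M g = (\<integral>\<^sup>+ x. c * g x \<partial>M)"
      by (simp add: nn_integral_eq_simple_integral nn_integral_cmult borel_measurable_simple_function)
    also have "\<dots> \<le> (\<integral>\<^sup>+ x. c * f x \<partial>M)"
      using g(2) by (intro nn_integral_mono mult_left_mono) (auto simp: le_fun_def)
    finally show "c * integral\<^sup>S M g \<le> (\<integral>\<^sup>+ x. c * f x \<partial>M)" .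
  qed
  finally show ?thesis .
qed

section \<open>The logarithmic weight and the assembly of both claims\<close>

lemma ln_le_nn_integral:
  assumes "0 < r" "r \<le> \<rho>" "a > 0" and l: "\<And>s. 0 < s \<Longrightarrow> s < \<rho> \<Longrightarrow> a \<le> l s"
  shows "ennreal (a * ln (\<rho> / r)) \<le> (\<integral>\<^sup>+ s \<in> {r<..<\<rho>}. ennreal (l s / s) \<partial>lborel)"
proof -
  have "(\<integral>\<^sup>+ s. ennreal (a / s) * indicator {r..\<rho>} s \<partial>lborel) = ennreal (a * ln \<rho> - a * ln r)"
    using assms by (intro nn_integral_FTC_Icc) (auto intro!: derivative_eq_intros)
  then have "ennreal (a * ln (\<rho> / r)) = (\<integral>\<^sup>+ s. ennreal (a / s) * indicator {r..\<rho>} s \<partial>lborel)"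
    using assms by (simp add: ln_div algebra_simps)
  also have "\<dots> \<le> (\<integral>\<^sup>+ s \<in> {r<..<\<rho>}. ennreal (l s / s) \<partial>lborel)"
  proof (rule nn_integral_mono_AE)
    show "AE s in lborel. ennreal (a / s) * indicator {r..\<rho>} s \<le> ennreal (l s / s) * indicator {r<..<\<rho>} s"
      using AE_lborel_singleton[of r] AE_lborel_singleton[of \<rho>]
      by eventually_elim (use assms in \<open>auto simp: indicator_def intro!: ennreal_leI divide_right_mono\<close>)
  qed
  finally show ?thesis .
qed

text \<open>The lower limit controls l near 0 and the assumed bounds control it away from 0. The two
  ranges meet at \<open>min b (\<rho> / 2)\<close>, which is below \<open>\<rho>\<close> as the
  second bound demands.\<close>

lemma positive_lower_bound:
  fixes l :: "real \<Rightarrow> real"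
  assumes bdd: "\<And>\<epsilon>. 0 < \<epsilon> \<Longrightarrow> \<epsilon> < \<rho> \<Longrightarrow> \<exists>a>0. \<forall>s. \<epsilon> \<le> s \<and> s < \<rho> \<longrightarrow> a \<le> l s"
    and "\<rho> > 0" and lim: "Liminf (at_right 0) (\<lambda>s. ereal (l s)) > 0"
  obtains a where "a > 0" "\<And>s. 0 < s \<Longrightarrow> s < \<rho> \<Longrightarrow> a \<le> l s"
proof -
  obtain y where y: "0 < y" "y < Liminf (at_right 0) (\<lambda>s. ereal (l s))"
    using dense[OF lim] by blast
  then obtain a1 where a1: "a1 > 0" "ereal a1 < Liminf (at_right 0) (\<lambda>s. ereal (l s))"
    by (cases y) auto
  then have "\<forall>\<^sub>F s in at_right 0. ereal a1 < ereal (l s)"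
    by (intro less_LiminfD)
  then obtain b where b: "b > 0" "\<And>s. 0 < s \<Longrightarrow> s < b \<Longrightarrow> a1 < l s"
    unfolding eventually_at_right_field by auto
  have "0 < min b (\<rho> / 2)" "min b (\<rho> / 2) < \<rho>" using b \<open>\<rho> > 0\<close> by (auto simp: min_def)
  then obtain a2 where a2: "a2 > 0" "\<And>s. min b (\<rho> / 2) \<le> s \<Longrightarrow> s < \<rho> \<Longrightarrow> a2 \<le> l s"
    using bdd by meson
  show ?thesis
  proof (rule that[of "min a1 a2"])
    show "min a1 a2 > 0" using a1 a2 by simp
    fix s assume s: "0 < s" "s < \<rho>"
    show "min a1 a2 \<le> l s"
    proof (cases "s < min b (\<rho> / 2)")
      case True
      then show ?thesis using b(2)[of s] s by auto
    next
      case False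
      then have "a2 \<le> l s" using s by (intro a2) auto
      then show ?thesis by simp
    qed
  qed
qed

theorem mainTheorem4:
  fixes J :: "'a::euclidean_space \<Rightarrow> 'a \<Rightarrow> real"
    and K :: "'a \<Rightarrow> real"
    and l :: "real \<Rightarrow> real"
    and \<rho> :: real
    and \<Omega> :: "'a set"
  assumes \<Omega>: "bounded \<Omega>" "open \<Omega>"
    and H0_meas: "(\<lambda>z. J (fst z) (snd z)) \<in> borel_measurable lebesgue"
    and H0_nonneg: "\<And>x y. J x y \<ge> 0"
    and H0_sym: "\<And>x y. J x y = J y x"
    and H0_int: "\<exists>C::real. \<forall>x. (\<integral>\<^sup>+ y. ennreal (min 1 ((norm (x - y))\<^sup>2) * J x y) \<partial>lebesgue) \<le> ennreal C"
    and K_meas: "K \<in> borel_measurable lebesgue"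
    and H0'_lower: "\<And>x y. J x y \<ge> K (x - y)"
    and H0'_nonneg: "\<And>z. K z \<ge> 0"
    and H0'_nonint: "\<And>\<epsilon>. \<epsilon> > 0 \<Longrightarrow> \<not> set_integrable lebesgue (ball 0 \<epsilon>) K"
    and H1_rho: "\<rho> > 0"
    and H1_pos: "\<And>s. 0 < s \<Longrightarrow> s < \<rho> \<Longrightarrow> l s > 0"
    and H1_bdd: "\<And>\<epsilon>. 0 < \<epsilon> \<Longrightarrow> \<epsilon> < \<rho> \<Longrightarrow>
        \<exists>a b. 0 < a \<and> (\<forall>s. \<epsilon> \<le> s \<and> s < \<rho> \<longrightarrow> a \<le> l s \<and> l s \<le> b)"
    and H1_K: "\<And>z. 0 < norm z \<Longrightarrow> norm z < \<rho> \<Longrightarrow> K z = l (norm z) / norm z ^ DIM('a)"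
    and H1_M: "filterlim (Mfun l \<rho>) at_top (at_right 0)"
    and H2: "\<And>t. t > 0 \<Longrightarrow> ((\<lambda>s. l (t * s) / l s) \<longlongrightarrow> 1) (at_right 0)"
  shows "(\<exists>c>0. \<forall>u \<in> HJ0 J \<Omega>.
            ennreal c * (\<integral>\<^sup>+ x \<in> \<Omega>. ennreal ((u x)\<^sup>2 *
               Mfun l \<rho> (\<rho> * norm x / (SUP y\<in>\<Omega>. norm y))) \<partial>lebesgue)
            \<le> energy J \<Omega> u)
       \<and> (Liminf (at_right 0) (\<lambda>s. ereal (l s)) > 0 \<longrightarrow>
          (\<exists>c>0. \<forall>u \<in> HJ0 J \<Omega>.
            ennreal c * (\<integral>\<^sup>+ x \<in> \<Omega>. ennreal ((u x)\<^sup>2 *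
               \<bar>ln (\<rho> * norm x / (SUP y\<in>\<Omega>. norm y))\<bar>) \<partial>lebesgue)
            \<le> energy J \<Omega> u))"
proof (cases "\<Omega> = {}")
  case True
  \<comment> \<open>For the empty domain the supremum has no meaning, but the integrals over it
    vanish.\<close>
  then show ?thesis by (auto intro: exI[of _ 1])
next
  case False
  define R where "R = (SUP y\<in>\<Omega>. norm y)"
  have bdd: "bdd_above (norm ` \<Omega>)"
    using \<Omega>(1) by (auto simp: bounded_iff bdd_above_def)
  have norm_le: "norm x \<le> R" if "x \<in> \<Omega>" for x
    unfolding R_def using that bdd by (intro cSUP_upper) auto
  \<comment> \<open>A nonempty open set is not just the origin, hence R > 0.\<close>
  obtain p where p: "p \<in> \<Omega>" "p \<noteq> 0"
  proof -
    have "\<Omega> \<noteq> {0}" using \<Omega>(2) by (metis not_open_singleton)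
    then show ?thesis using False that by auto
  qed
  have R: "R > 0" using norm_le[OF p(1)] p(2) by (smt (verit) zero_less_norm_iff)
  define m where "m r = (\<integral>\<^sup>+ s \<in> {r<..<\<rho>}. ennreal (l s / s) \<partial>lborel)" for r
  have l_upper: "\<exists>b. \<forall>s. \<epsilon> \<le> s \<and> s < \<rho> \<longrightarrow> l s \<le> b" if "0 < \<epsilon>" "\<epsilon> < \<rho>" for \<epsilon>
    using H1_bdd[OF that] by meson
  have l_lower: "\<exists>a>0. \<forall>s. \<epsilon> \<le> s \<and> s < \<rho> \<longrightarrow> a \<le> l s" if "0 < \<epsilon>" "\<epsilon> < \<rho>" for \<epsilon>
    using H1_bdd[OF that] by meson
  have "\<exists>C. \<forall>u \<in> HJ0 J \<Omega>.
    (\<integral>\<^sup>+ x. ennreal ((u x)\<^sup>2) * (m (\<rho> / R * norm x) + 1) \<partial>lebesgue) \<le> ennreal C * energy J \<Omega> u"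
    unfolding m_def
    using \<Omega>(1) H0_sym K_meas H0'_lower H0'_nonneg H1_rho H1_pos l_upper H1_K H1_M H2[of 2] R
    by (intro hardy_energy[where J = J and K = K]) auto
  then obtain C where C: "\<And>u. u \<in> HJ0 J \<Omega> \<Longrightarrow>
    (\<integral>\<^sup>+ x. ennreal ((u x)\<^sup>2) * (m (\<rho> / R * norm x) + 1) \<partial>lebesgue) \<le> ennreal C * energy J \<Omega> u"
    by blast
  \<comment> \<open>Both claims are instances. For nonzero x in the domain the argument
    \<open>\<rho> * norm x / R\<close> lies in the interval from 0 (excluded) to
    \<open>\<rho>\<close>, so domination of g there suffices. Taking \<open>max 1 C\<close> below
    makes the divisor positive whatever the sign of C.\<close>
  have weighted: "\<exists>c>0. \<forall>u \<in> HJ0 J \<Omega>. ennreal c * (\<integral>\<^sup>+ x \<in> \<Omega>. ennreal ((u x)\<^sup>2 * g (\<rho> * norm x / R)) \<partial>lebesgue) \<le> energy J \<Omega> u"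
    if "D > 0" and g: "\<And>r. 0 < r \<Longrightarrow> r \<le> \<rho> \<Longrightarrow> ennreal (g r) \<le> ennreal D * (m r + 1)" for g :: "real \<Rightarrow> real" and D
  proof (intro exI[of _ "1 / max 1 C * (1 / D)"] conjI ballI)
    show "1 / max 1 C * (1 / D) > 0" using \<open>D > 0\<close> by simp
    fix u assume u: "u \<in> HJ0 J \<Omega>"
    have "ennreal (1 / D) * (\<integral>\<^sup>+ x \<in> \<Omega>. ennreal ((u x)\<^sup>2 * g (\<rho> * norm x / R)) \<partial>lebesgue)
      \<le> (\<integral>\<^sup>+ x. ennreal (1 / D) * (ennreal ((u x)\<^sup>2 * g (\<rho> * norm x / R)) * indicator \<Omega> x) \<partial>lebesgue)"
      by (rule nn_integral_cmult_le)
    also have "\<dots> \<le> (\<integral>\<^sup>+ x. ennreal ((u x)\<^sup>2) * (m (\<rho> / R * norm x) + 1) \<partial>lebesgue)"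
      unfolding nn_integral_completion
    proof (rule nn_integral_mono_AE)
      show "AE x in lborel. ennreal (1 / D) * (ennreal ((u x)\<^sup>2 * g (\<rho> * norm x / R)) * indicator \<Omega> x)
        \<le> ennreal ((u x)\<^sup>2) * (m (\<rho> / R * norm x) + 1)"
        using AE_lborel_singleton[of "0::'a"]
      proof eventually_elim
        case (elim x)
        show ?case
        proof (cases "x \<in> \<Omega>")
          case True
          have "\<rho> * norm x \<le> \<rho> * R" using norm_le[OF True] H1_rho by simp
          then have "ennreal (g (\<rho> * norm x / R)) \<le> ennreal D * (m (\<rho> * norm x / R) + 1)"
            using elim H1_rho R by (intro g) (auto simp: field_simps)
          then have "ennreal (1 / D) * (ennreal ((u x)\<^sup>2) * ennreal (g (\<rho> * norm x / R)))
              \<le> ennreal (1 / D) * (ennreal ((u x)\<^sup>2) * (ennreal D * (m (\<rho> * norm x / R) + 1)))"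
            by (intro mult_left_mono) simp_all
          also have "\<dots> = (ennreal (1 / D) * ennreal D) * (ennreal ((u x)\<^sup>2) * (m (\<rho> * norm x / R) + 1))"
            by (simp only: mult_ac)
          also have "ennreal (1 / D) * ennreal D = 1"
            using \<open>D > 0\<close> by (simp flip: ennreal_mult)
          finally show ?thesis using True by (simp add: ennreal_mult' mult_ac)
        qed simp
      qed
    qed
    also have "\<dots> \<le> ennreal C * energy J \<Omega> u" by (rule C[OF u])
    also have "\<dots> \<le> ennreal (max 1 C) * energy J \<Omega> u"
      by (intro mult_right_mono ennreal_leI) auto
    finally have "ennreal (1 / max 1 C) * (ennreal (1 / D) * (\<integral>\<^sup>+ x \<in> \<Omega>. ennreal ((u x)\<^sup>2 * g (\<rho> * norm x / R)) \<partial>lebesgue))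
      \<le> ennreal (1 / max 1 C) * (ennreal (max 1 C) * energy J \<Omega> u)"
      by (rule mult_left_mono) simp
    also have "\<dots> = (ennreal (1 / max 1 C) * ennreal (max 1 C)) * energy J \<Omega> u"
      by (simp only: mult.assoc)
    also have "ennreal (1 / max 1 C) * ennreal (max 1 C) = ennreal (1 / max 1 C * max 1 C)"
      by (rule ennreal_mult[symmetric]) auto
    also have "1 / max 1 C * max 1 C = 1"
      by simp
    finally show "ennreal (1 / max 1 C * (1 / D)) * (\<integral>\<^sup>+ x \<in> \<Omega>. ennreal ((u x)\<^sup>2 * g (\<rho> * norm x / R)) \<partial>lebesgue) \<le> energy J \<Omega> u"
      using \<open>D > 0\<close> by (subst ennreal_mult) (auto simp: mult.assoc)
  qed
  show ?thesis
    unfolding R_def[symmetric]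
  proof (intro conjI impI)
    show "\<exists>c>0. \<forall>u \<in> HJ0 J \<Omega>. ennreal c * (\<integral>\<^sup>+ x \<in> \<Omega>. ennreal ((u x)\<^sup>2 * Mfun l \<rho> (\<rho> * norm x / R)) \<partial>lebesgue) \<le> energy J \<Omega> u"
    proof (rule weighted[of 1])
      fix r :: real
      \<comment> \<open>\<open>enn2real\<close> sends infinity to 0, so in general only this
        inequality is available; it is the direction required.\<close>
      have "ennreal (Mfun l \<rho> r) \<le> m r"
        by (auto simp: Mfun_def m_def ennreal_enn2real_if)
      then show "ennreal (Mfun l \<rho> r) \<le> ennreal 1 * (m r + 1)"
        by (rule order_trans) simp
    qed simp
    assume "Liminf (at_right 0) (\<lambda>s. ereal (l s)) > 0"
    then obtain a where a: "a > 0" "\<And>s. 0 < s \<Longrightarrow> s < \<rho> \<Longrightarrow> a \<le> l s"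
      using positive_lower_bound[OF l_lower H1_rho] by blast
    show "\<exists>c>0. \<forall>u \<in> HJ0 J \<Omega>. ennreal c * (\<integral>\<^sup>+ x \<in> \<Omega>. ennreal ((u x)\<^sup>2 * \<bar>ln (\<rho> * norm x / R)\<bar>) \<partial>lebesgue) \<le> energy J \<Omega> u"
    \<comment> \<open>From ln r = ln \<open>\<rho>\<close> - ln(\<open>\<rho>\<close>/r), the
      modulus of ln r is at most ln(\<open>\<rho>\<close>/r) plus a constant. The first term is at
      most \<open>1 / a\<close> times the weight; the constant is absorbed by the summand 1.\<close>
    proof (rule weighted[of "1 / a + \<bar>ln \<rho>\<bar>"])
      show "1 / a + \<bar>ln \<rho>\<bar> > 0" using a by (simp add: add_pos_nonneg)
      fix r :: real assume r: "0 < r" "r \<le> \<rho>"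
      have "0 \<le> ln (\<rho> / r)" using r by simp
      have "\<bar>ln r\<bar> \<le> 1 / a * (a * ln (\<rho> / r)) + \<bar>ln \<rho>\<bar>"
      proof -
        have "ln (\<rho> / r) = ln \<rho> - ln r" using r by (simp add: ln_div)
        moreover have "1 / a * (a * ln (\<rho> / r)) = ln (\<rho> / r)" using a by simp
        ultimately show ?thesis using \<open>0 \<le> ln (\<rho> / r)\<close> by linarith
      qed
      then have "ennreal \<bar>ln r\<bar> \<le> ennreal (1 / a * (a * ln (\<rho> / r)) + \<bar>ln \<rho>\<bar>)"
        by (rule ennreal_leI)
      also have "\<dots> = ennreal (1 / a) * ennreal (a * ln (\<rho> / r)) + ennreal \<bar>ln \<rho>\<bar>"
        using a \<open>0 \<le> ln (\<rho> / r)\<close> by (subst ennreal_plus) (auto simp: ennreal_mult'[symmetric] simp del: ennreal_mult')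
      also have "\<dots> \<le> ennreal (1 / a) * m r + ennreal \<bar>ln \<rho>\<bar> * 1"
        unfolding m_def using r a by (intro add_mono mult_left_mono ln_le_nn_integral) auto
      also have "\<dots> \<le> ennreal (1 / a + \<bar>ln \<rho>\<bar>) * m r + ennreal (1 / a + \<bar>ln \<rho>\<bar>) * 1"
        using a by (intro add_mono mult_right_mono ennreal_leI) auto
      also have "\<dots> = ennreal (1 / a + \<bar>ln \<rho>\<bar>) * (m r + 1)"
        by (simp only: distrib_left)
      finally show "ennreal \<bar>ln r\<bar> \<le> ennreal (1 / a + \<bar>ln \<rho>\<bar>) * (m r + 1)" .
    qed
  qed
qed

end
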